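(* Consider the power network under grid-forming frequency shaping control described in the context, with the matrices $\boldsymbol{M},\boldsymbol{D},\boldsymbol{T},\boldsymbol{R},\boldsymbol{L}_\mathrm{B}$ and the stacked internal state $\boldsymbol{q}$ defined there, and its transient control effort $$C_{\infty,\Delta P}:=\int_0^\infty(\boldsymbol{u}_\mathrm{P}-\boldsymbol{u}_\mathrm{P}(\infty))^T(\boldsymbol{u}_\mathrm{P}-\boldsymbol{u}_\mathrm{P}(\infty))\,\mathrm{d}t$$ following step power disturbances with net power imbalance of magnitude $\Delta P$. This transient control effort is approximately given by $$C_{\infty,\Delta P}\approx\frac{(\Delta P)^2}{n}\|G\|_{\mathcal{H}_2}^2=\frac{(\Delta P)^2}{n}\,\mathrm{tr}(\boldsymbol{B}^T\boldsymbol{X}\boldsymbol{B}),$$ where the sense of $\approx$ is the one described in the context, and $G$ denotes the following system with input $\dot{\boldsymbol{p}}_\mathrm{in}$ and output $\boldsymbol{u}_\mathrm{P}-\boldsymbol{u}_\mathrm{P}(\infty)$: $$\begin{bmatrix}\dot{\boldsymbol{\omega}}\\\ddot{\boldsymbol{\omega}}\\\dot{\boldsymbol{q}}\end{bmatrix}=\boldsymbol{A}\begin{bmatrix}\boldsymbol{\omega}\\\dot{\boldsymbol{\omega}}\\\boldsymbol{q}\end{bmatrix}+\boldsymbol{B}\,\dot{\boldsymbol{p}}_\mathrm{in},\qquad \boldsymbol{u}_\mathrm{P}-\boldsymbol{u}_\mathrm{P}(\infty)=\boldsymbol{C}\begin{bmatrix}\boldsymbol{\omega}\\\dot{\boldsymbol{\omega}}\\\boldsymbol{q}\end{bmatrix},$$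 with $$\boldsymbol{A}:=\begin{bmatrix}\boldsymbol{0}_{n\times n}&\boldsymbol{I}_n&\boldsymbol{0}_{n\times n}\\-\boldsymbol{M}^{-1}(\boldsymbol{T}^{-1}\boldsymbol{R}+\boldsymbol{L}_\mathrm{B})&-\boldsymbol{M}^{-1}\boldsymbol{D}&-(\boldsymbol{M}\boldsymbol{T})^{-1}\\-\boldsymbol{T}^{-1}\boldsymbol{R}&\boldsymbol{0}_{n\times n}&-\boldsymbol{T}^{-1}\end{bmatrix},\qquad \boldsymbol{B}:=\begin{bmatrix}\boldsymbol{0}_{n\times n}\\\boldsymbol{M}^{-1}\\\boldsymbol{0}_{n\times n}\end{bmatrix},$$ $$\boldsymbol{C}:=\left[\boldsymbol{I}_n-\frac{(\boldsymbol{D}+\boldsymbol{R})\boldsymbol{1}_n\boldsymbol{1}_n^T}{\boldsymbol{1}_n^T\boldsymbol{D}\boldsymbol{1}_n}\right]\begin{bmatrix}\boldsymbol{D}&\boldsymbol{M}&-\boldsymbol{I}_n\end{bmatrix},$$ and $\boldsymbol{X}$ is the observability Gramian, which can be uniquely solved from the following Lyapunov equation with an additional constraint via $\boldsymbol{v}:=\begin{bmatrix}\boldsymbol{1}_n^T&\boldsymbol{0}_n^T&-(\boldsymbol{R}\boldsymbol{1}_n)^T\end{bmatrix}^T$: $$\boldsymbol{A}^T\boldsymbol{X}+\boldsymbol{X}\boldsymbol{A}=-\boldsymbol{C}^T\boldsymbol{C},\qquad \boldsymbol{X}\boldsymbol{v}=\boldsymbol{0}_{3n}.$$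
   Context: Notation: $\boldsymbol{1}_n,\boldsymbol{0}_n\in\mathbb{R}^n$ are the all-ones and all-zeros vectors, $\boldsymbol{e}_i$ is the $i$-th standard basis vector of $\mathbb{R}^n$, and hats denote Laplace transforms. Network. The buses are $\mathcal{N}=\{1,\dots,n\}$, partitioned into generators $\mathcal{G}=\{1,\dots,|\mathcal{G}|\}$ and inverters $\mathcal{I}=\{|\mathcal{G}|+1,\dots,n\}$; transmission lines are unordered pairs of distinct buses. The input is the vector of power injection changes $\boldsymbol{p}_\mathrm{in}\in\mathbb{R}^n$, the output is the vector of bus frequency deviations $\boldsymbol{\omega}\in\mathbb{R}^n$, and $\boldsymbol{p}_\mathrm{e}\in\mathbb{R}^n$ denotes the network power fluctuations. The net bus power imbalance is $\boldsymbol{u}_\mathrm{P}=\boldsymbol{p}_\mathrm{in}-\boldsymbol{p}_\mathrm{e}$. Bus dynamics. Each bus maps $u_{\mathrm{P},i}$ to $\omega_i$. For $i\in\mathcal{G}$: $m_i\dot\omega_i=-d_i\omega_i+q_{\mathrm{t},i}+u_{\mathrm{P},i}$ and $\tau_i\dot q_{\mathrm{t},i}=-\alpha_{\mathrm{t},i}\omega_i-q_{\mathrm{t},i}$, with $m_i,d_i,\tau_i,\alpha_{\mathrm{t},i}>0$. For $i\in\mathcal{I}$ (grid-forming frequency shaping control) the transfer function is $\left(m_is+d_i-\frac{\rho_i}{\sigma_is+1}\right)^{-1}$, with $m_i>0$, $d_i>\rho_i\ge0$, $\sigma_i>0$; in the time domain, $m_i\dot\omega_i=-d_i\omega_i+q_{\mathrm{r},i}+u_{\mathrm{P},i}$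 and $\sigma_i\dot q_{\mathrm{r},i}=\rho_i\omega_i-q_{\mathrm{r},i}$, where $q_{\mathrm{r},i}$ is an internal controller state. The inverter parameters are required to satisfy, for all $s$, $\sum_{i\in\mathcal{I}}\frac{\rho_i}{\sigma_is+1}=\sum_{i\in\mathcal{G}}\frac{\alpha_{\mathrm{t},i}}{\tau_is+1}$. Network dynamics. $\hat{\boldsymbol{p}}_\mathrm{e}(s)=\frac{\boldsymbol{L}_\mathrm{B}}{s}\hat{\boldsymbol{\omega}}(s)$, where $\boldsymbol{L}_\mathrm{B}\in\mathbb{R}^{n\times n}$ is an undirected weighted Laplacian matrix of the transmission network with entries $L_{\mathrm{B},ij}=\Omega_0\,\partial_{\theta_j}\sum_{l=1}^n|V_i||V_l|B_{il}\sin(\theta_i-\theta_l)\big|_{\boldsymbol{\theta}=\boldsymbol{\theta}_0}$; here $\boldsymbol{\theta}$ are voltage angles with equilibrium $\boldsymbol{\theta}_0$, $|V_i|$ constant voltage magnitudes, $B_{ij}$ line susceptances, and $\Omega_0$ the nominal angular frequency. Matrices. $\boldsymbol{M}=\mathrm{diag}(m_i,i\in\mathcal{N})$, $\boldsymbol{D}=\mathrm{diag}(d_i,i\in\mathcal{N})$; $\boldsymbol{T}$ is diagonal with entries $\tau_i$ ($i\in\mathcal{G}$) and $\sigma_i$ ($i\in\mathcal{I}$); $\boldsymbol{R}$ is diagonal with entries $\alpha_{\mathrm{t},i}$ ($i\in\mathcal{G}$) and $-\rho_i$ ($i\in\mathcal{I}$); $\boldsymbol{q}$ stacks $(q_{\mathrm{t},i},i\in\mathcal{G})$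 and $(q_{\mathrm{r},i},i\in\mathcal{I})$. Disturbance. The system experiences step disturbances $\boldsymbol{p}_\mathrm{in}=\boldsymbol{u}_0$ for $t\ge0$ (zero before), so that $\dot{\boldsymbol{p}}_\mathrm{in}=\boldsymbol{u}_0\delta(t)$, with $\boldsymbol{u}_0\in\mathbb{R}^n$ an arbitrary vector direction and net imbalance of magnitude $|\sum_{i=1}^nu_{0,i}|=\Delta P$; $\boldsymbol{u}_\mathrm{P}(\infty)$ is the steady-state value of $\boldsymbol{u}_\mathrm{P}$. Sense of the approximation. The sign $\approx$ is not accompanied by an error bound. It means that $C_{\infty,\Delta P}$ is estimated by the average, over $n$ experiments, of the squared $\mathcal{L}_2$ norms of the outputs of $G$, where in the $i$-th experiment the input $\dot{\boldsymbol{p}}_\mathrm{in}=-\Delta P\,\boldsymbol{e}_i\,\delta(t)$ is applied to $G$. $\mathcal{H}_2$ norm and Gramian. $\|G\|_{\mathcal{H}_2}^2$ is the sum over $i=1,\dots,n$ of the squared $\mathcal{L}_2$ norms of the outputs of $G$ when a unit impulse is applied at the $i$-th input channel individually. The observability Gramian is $\int_0^\infty e^{\boldsymbol{A}^Tt}\boldsymbol{C}^T\boldsymbol{C}e^{\boldsymbol{A}t}\,\mathrm{d}t$.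
   Formalization: The transmission network is assumed connected with symmetric susceptances and positive line weights in L_B; for a disconnected network the Gramian integral diverges and the Lyapunov equation has no solution. *)

theory Defs
  imports "HOL-Analysis.Analysis"
begin

section \<open>Block matrices and the matrix exponential\<close>

text \<open>A matrix is a vector of rows, so \<open>stack3\<close> stacks column vectors as well as blocks of rows.\<close>

definition stack3 :: "'a^'n \<Rightarrow> 'a^'n \<Rightarrow> 'a^'n \<Rightarrow> 'a^('n + 'n + 'n)" where
  "stack3 a b c = (\<chi> k. case k of Inl i \<Rightarrow> a $ i | Inr (Inl i) \<Rightarrow> b $ i | Inr (Inr i) \<Rightarrow> c $ i)"

definition beside3 :: "'a^'n^'m \<Rightarrow> 'a^'n^'m \<Rightarrow> 'a^'n^'m \<Rightarrow> 'a^('n + 'n + 'n)^'m" where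
  "beside3 P Q S = (\<chi> r. stack3 (P $ r) (Q $ r) (S $ r))"

definition diag_matrix :: "('n \<Rightarrow> real) \<Rightarrow> real^'n^'n" where
  "diag_matrix f = (\<chi> i j. if i = j then f i else 0)"

text \<open>The operations \<open>*\<close> and \<open>^\<close> on the type \<open>real^'k^'k\<close> are not those of matrix algebra;
  powers and the exponential with respect to \<open>**\<close> are therefore introduced here.\<close>

primrec matrix_power :: "real^'k^'k \<Rightarrow> nat \<Rightarrow> real^'k^'k" where
  "matrix_power A 0 = mat 1"
| "matrix_power A (Suc k) = A ** matrix_power A k"

definition matrix_exp :: "real^'k^'k \<Rightarrow> real^'k^'k" where
  "matrix_exp A = (\<Sum>k. (1 / fact k) *\<^sub>R matrix_power A k)"


section \<open>Linear systems driven by the derivative of a signal\<close>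

definition step_signal :: "real^'n \<Rightarrow> real \<Rightarrow> real^'n" where
  "step_signal u t = (if t \<ge> 0 then u else 0)"

text \<open>State \<open>x\<close> of \<open>x' = A x + B p'\<close>, at rest for negative times, where \<open>p\<close> vanishes for negative
  times and its derivative \<open>p'\<close> may contain an impulse at time 0. Integrating the equation from
  \<open>0-\<close> to \<open>t\<close> gives \<open>x t = (integral of A x over {0..t}) + B (p t)\<close>. For \<open>p = step_signal u\<close> the
  input \<open>p'\<close> is the impulse with direction \<open>u\<close>.\<close>

definition state_response ::
  "real^'k^'k \<Rightarrow> real^'n^'k \<Rightarrow> (real \<Rightarrow> real^'n) \<Rightarrow> (real \<Rightarrow> real^'k) \<Rightarrow> bool" where
  "state_response A B p x \<longleftrightarrow>
     (\<forall>t<0. x t = 0) \<and>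
     (\<forall>t\<ge>0. ((\<lambda>s. A *v x s) has_integral (x t - B *v p t)) {0..t})"

definition impulse_output ::
  "real^'k^'k \<Rightarrow> real^'n^'k \<Rightarrow> real^'k^'m \<Rightarrow> real^'n \<Rightarrow> real \<Rightarrow> real^'m" where
  "impulse_output A B C u =
     (THE y. \<exists>x. state_response A B (step_signal u) x \<and> y = (\<lambda>t. C *v x t))"

definition l2_norm_sq :: "(real \<Rightarrow> real^'m) \<Rightarrow> real" where
  "l2_norm_sq y = integral {0..} (\<lambda>t. (norm (y t))\<^sup>2)"

definition h2_norm_sq :: "real^'k^'k \<Rightarrow> real^'n^'k \<Rightarrow> real^'k^'m \<Rightarrow> real" where
  "h2_norm_sq A B C = (\<Sum>i\<in>UNIV. l2_norm_sq (impulse_output A B C (axis i 1)))"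

definition gramian_integrand :: "real^'k^'k \<Rightarrow> real^'k^'m \<Rightarrow> real \<Rightarrow> real^'k^'k" where
  "gramian_integrand A C t =
     matrix_exp (t *\<^sub>R transpose A) ** transpose C ** C ** matrix_exp (t *\<^sub>R A)"

definition observability_gramian :: "real^'k^'k \<Rightarrow> real^'k^'m \<Rightarrow> real^'k^'k" where
  "observability_gramian A C = integral {0..} (gramian_integrand A C)"


section \<open>The power network\<close>

text \<open>Buses are the elements of the finite type \<open>'n\<close>. The turbine parameters are relevant at
  generators only, the controller parameters at inverters only.\<close>

record 'n network =
  gens :: "'n set"
  lines :: "'n set set"
  inertia :: "'n \<Rightarrow> real"        \<comment> \<open>\<open>m\<close>\<close>
  damping :: "'n \<Rightarrow> real"        \<comment> \<open>\<open>d\<close>\<close>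
  turb_time :: "'n \<Rightarrow> real"      \<comment> \<open>\<open>\<tau>\<close>\<close>
  turb_droop :: "'n \<Rightarrow> real"     \<comment> \<open>\<open>\<alpha>\<^sub>t\<close>\<close>
  ctrl_time :: "'n \<Rightarrow> real"      \<comment> \<open>\<open>\<sigma>\<close>\<close>
  ctrl_gain :: "'n \<Rightarrow> real"      \<comment> \<open>\<open>\<rho>\<close>\<close>
  nominal_freq :: real          \<comment> \<open>\<open>\<Omega>\<^sub>0\<close>\<close>
  volt_mag :: "'n \<Rightarrow> real"       \<comment> \<open>\<open>|V|\<close>\<close>
  suscept :: "'n \<Rightarrow> 'n \<Rightarrow> real"
  eq_angle :: "'n \<Rightarrow> real"       \<comment> \<open>\<open>\<theta>\<^sub>0\<close>\<close>

definition invs :: "'n network \<Rightarrow> 'n set" where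
  "invs N = - gens N"

definition line_weight :: "'n network \<Rightarrow> 'n \<Rightarrow> 'n \<Rightarrow> real" where
  "line_weight N i j =
     nominal_freq N * volt_mag N i * volt_mag N j * suscept N i j * cos (eq_angle N i - eq_angle N j)"

text \<open>An undirected, connected network with positive line weights. The weights are the negated
  off-diagonal entries of \<open>LB_matrix\<close> below.\<close>

definition transmission_network :: "'n network \<Rightarrow> bool" where
  "transmission_network N \<longleftrightarrow>
     (\<forall>e\<in>lines N. \<exists>i j. i \<noteq> j \<and> e = {i, j}) \<and>
     (\<forall>i j. (i, j) \<in> {(a, b). {a, b} \<in> lines N}\<^sup>*) \<and>
     nominal_freq N > 0 \<and> (\<forall>i. volt_mag N i \<ge> 0) \<and>
     (\<forall>i j. suscept N i j = suscept N j i) \<and>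
     (\<forall>i j. i \<noteq> j \<longrightarrow> {i, j} \<notin> lines N \<longrightarrow> suscept N i j = 0) \<and>
     (\<forall>i j. {i, j} \<in> lines N \<longrightarrow> line_weight N i j > 0)"

definition bus_parameters :: "'n network \<Rightarrow> bool" where
  "bus_parameters N \<longleftrightarrow>
     (\<forall>i\<in>gens N. inertia N i > 0 \<and> damping N i > 0 \<and> turb_time N i > 0 \<and> turb_droop N i > 0) \<and>
     (\<forall>i\<in>invs N. inertia N i > 0 \<and> damping N i > ctrl_gain N i \<and> ctrl_gain N i \<ge> 0 \<and> ctrl_time N i > 0)"

text \<open>The inverter tuning, as an identity of rational functions: poles are excluded because division
  by zero would otherwise silently drop summands.\<close>

definition frequency_shaping :: "('n::finite) network \<Rightarrow> bool" where
  "frequency_shaping N \<longleftrightarrow>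
     (\<forall>s::complex.
        (\<forall>i\<in>invs N. of_real (ctrl_time N i) * s + 1 \<noteq> 0) \<longrightarrow>
        (\<forall>i\<in>gens N. of_real (turb_time N i) * s + 1 \<noteq> 0) \<longrightarrow>
        (\<Sum>i\<in>invs N. of_real (ctrl_gain N i) / (of_real (ctrl_time N i) * s + 1)) =
        (\<Sum>i\<in>gens N. of_real (turb_droop N i) / (of_real (turb_time N i) * s + 1)))"

definition M_matrix :: "('n::finite) network \<Rightarrow> real^'n^'n" where
  "M_matrix N = diag_matrix (inertia N)"

definition D_matrix :: "('n::finite) network \<Rightarrow> real^'n^'n" where
  "D_matrix N = diag_matrix (damping N)"

definition T_matrix :: "('n::finite) network \<Rightarrow> real^'n^'n" where
  "T_matrix N = diag_matrix (\<lambda>i. if i \<in> gens N then turb_time N i else ctrl_time N i)"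

definition R_matrix :: "('n::finite) network \<Rightarrow> real^'n^'n" where
  "R_matrix N = diag_matrix (\<lambda>i. if i \<in> gens N then turb_droop N i else - ctrl_gain N i)"

definition line_flow_sum :: "('n::finite) network \<Rightarrow> 'n \<Rightarrow> ('n \<Rightarrow> real) \<Rightarrow> real" where
  "line_flow_sum N i \<theta> =
     (\<Sum>l\<in>UNIV. volt_mag N i * volt_mag N l * suscept N i l * sin (\<theta> i - \<theta> l))"

definition LB_matrix :: "('n::finite) network \<Rightarrow> real^'n^'n" where
  "LB_matrix N = (\<chi> i j. nominal_freq N *
     deriv (\<lambda>x. line_flow_sum N i ((eq_angle N)(j := x))) (eq_angle N j))"


section \<open>Step responses and the transient control effort\<close>

text \<open>Trajectory of the network, at rest before time 0, under the power injection change
  \<open>p_in = step_signal u0\<close>. The signal \<open>\<omega>'\<close> is the derivative of \<open>\<omega>\<close>; at time 0, where it jumps, it is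
  the one from the right. The equation \<open>p_e = (L_B / s) \<omega>\<close> between Laplace transforms says that
  \<open>p_e\<close> is the integral of \<open>L_B \<omega>\<close> from time 0.\<close>

definition network_step_response ::
  "('n::finite) network \<Rightarrow> real^'n \<Rightarrow> (real \<Rightarrow> real^'n) \<Rightarrow> (real \<Rightarrow> real^'n) \<Rightarrow>
   (real \<Rightarrow> real^'n) \<Rightarrow> (real \<Rightarrow> real^'n) \<Rightarrow> bool" where
  "network_step_response N u0 \<omega> \<omega>' q p_e \<longleftrightarrow>
     (\<forall>t<0. \<omega> t = 0 \<and> \<omega>' t = 0 \<and> q t = 0 \<and> p_e t = 0) \<and>
     \<omega> 0 = 0 \<and> q 0 = 0 \<and>
     (\<forall>t\<ge>0.
        (\<omega> has_vector_derivative \<omega>' t) (at t within {0..}) \<and>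
        (\<forall>i. inertia N i * \<omega>' t $ i =
             - damping N i * \<omega> t $ i + q t $ i + (step_signal u0 t - p_e t) $ i) \<and>
        (\<forall>i\<in>gens N. \<exists>q'. ((\<lambda>s. q s $ i) has_real_derivative q') (at t within {0..}) \<and>
             turb_time N i * q' = - turb_droop N i * \<omega> t $ i - q t $ i) \<and>
        (\<forall>i\<in>invs N. \<exists>q'. ((\<lambda>s. q s $ i) has_real_derivative q') (at t within {0..}) \<and>
             ctrl_time N i * q' = ctrl_gain N i * \<omega> t $ i - q t $ i) \<and>
        ((\<lambda>s. LB_matrix N *v \<omega> s) has_integral p_e t) {0..t})"

definition effort_integrand :: "(real \<Rightarrow> real^'n) \<Rightarrow> real \<Rightarrow> real" where
  "effort_integrand u_P t = (u_P t - Lim at_top u_P) \<bullet> (u_P t - Lim at_top u_P)"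

definition transient_effort :: "(real \<Rightarrow> real^'n) \<Rightarrow> real" where
  "transient_effort u_P = integral {0..} (effort_integrand u_P)"


section \<open>The state-space system and the effort estimate\<close>

definition A_matrix :: "('n::finite) network \<Rightarrow> real^('n + 'n + 'n)^('n + 'n + 'n)" where
  "A_matrix N =
     (let M = M_matrix N; D = D_matrix N; T = T_matrix N; R = R_matrix N; L = LB_matrix N in
      stack3
        (beside3 (mat 0) (mat 1) (mat 0))
        (beside3 (- (matrix_inv M ** (matrix_inv T ** R + L))) (- (matrix_inv M ** D))
                 (- matrix_inv (M ** T)))
        (beside3 (- (matrix_inv T ** R)) (mat 0) (- matrix_inv T)))"

definition B_matrix :: "('n::finite) network \<Rightarrow> real^'n^('n + 'n + 'n)" where
  "B_matrix N = stack3 (mat 0) (matrix_inv (M_matrix N)) (mat 0)"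

definition C_matrix :: "('n::finite) network \<Rightarrow> real^('n + 'n + 'n)^'n" where
  "C_matrix N =
     (let M = M_matrix N; D = D_matrix N; R = R_matrix N; ones = vec 1 in
      (mat 1 - (1 / (ones \<bullet> (D *v ones))) *\<^sub>R
         (columnvector ((D + R) *v ones) ** (rowvector ones :: real^'n^1)))
      ** beside3 D M (- mat 1))"

definition v_vector :: "('n::finite) network \<Rightarrow> real^('n + 'n + 'n)" where
  "v_vector N = stack3 (vec 1) 0 (- (R_matrix N *v vec 1))"

text \<open>The number by which the transient control effort of a disturbance with net imbalance \<open>\<Delta>P\<close> is
  approximated. No error bound is attached to the approximation; it means averaging the output
  energy over the experiments in which the whole imbalance occurs at a single bus.\<close>

definition effort_estimate :: "('n::finite) network \<Rightarrow> real \<Rightarrow> real" where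
  "effort_estimate N \<Delta>P =
     (\<Sum>i\<in>UNIV. l2_norm_sq
        (impulse_output (A_matrix N) (B_matrix N) (C_matrix N) (- \<Delta>P *\<^sub>R axis i 1)))
     / real CARD('n)"

end

theory Submission
  imports Defs
begin

text \<open>With \<open>u = M \<omega>' + D \<omega> - q\<close>, the net power imbalance, the system reads \<open>M \<omega>' = u - D \<omega> + q\<close>,
  \<open>u' = - L\<^sub>B \<omega>\<close>, \<open>T q' = - R \<omega> - q\<close>. The sum of \<open>u\<close> is conserved, and frequency shaping gives
  \<open>tr R = 0\<close>, so that the equilibria are the multiples of \<open>v\<close> and each state determines its limit
  through the sum of \<open>u\<close>. On states with sum 0 the energy
  \<open>(u\<^sup>T L\<^sub>B\<^sup>+ u + \<omega>\<^sup>T M \<omega> + q\<^sup>T T K q) / 2\<close>, corrected by a small multiple of \<open>u\<^sup>T M \<omega>\<close>, is a strict Lyapunov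
  function. Hence \<open>exp (t A)\<close> converges exponentially to the projection \<open>v w\<^sup>T\<close> onto the equilibria, which
  \<open>C\<close> annihilates. All output energies are therefore finite, and the Gramian is the only solution of the
  Lyapunov equation that vanishes on \<open>v\<close>.\<close>

section \<open>Matrix exponentials and impulse responses\<close>

text \<open>\<open>A\<close> is singular, so the Gramian integral cannot be obtained from asymptotic
  stability; its convergence rests on the output not seeing the kernel of \<open>A\<close>. The
  usual storage function weights the square of an internal state by \<open>1 / r\<close>, which
  removes its product with the frequency. At inverters \<open>r\<close> is not positive and this
  weight fails. The weight \<open>1 / (2 * d + r)\<close> tolerates a product term and still leaves
  a definite form as long as \<open>d + r > 0\<close>. The odd-looking rank-one factor in
  \<open>C\<close> is the projection onto the equilibria seen through \<open>u\<close>: the vector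
  \<open>v\<close> carries the imbalance (D + R) 1, and the sum of this vector is 1^T D 1 because tr
  R = 0. An explicit exponential rate is proved, not mere convergence, because all integrals over
  the half-line are controlled by domination.\<close>

lemma bounded_bilinear_matrix_matrix_mult:
  "bounded_bilinear ((**) :: real^'n^'m \<Rightarrow> real^'p^'n \<Rightarrow> real^'p^'m)"
  unfolding bilinear_conv_bounded_bilinear[symmetric] bilinear_def
  by (auto intro!: linearI simp: vec_eq_iff matrix_matrix_mult_def sum.distrib sum_distrib_left algebra_simps)

lemma bounded_bilinear_matrix_vector_mult:
  "bounded_bilinear ((*v) :: real^'n^'m \<Rightarrow> real^'n \<Rightarrow> real^'m)"
  unfolding bilinear_conv_bounded_bilinear[symmetric] bilinear_def
  by (auto intro!: linearI simp: vec_eq_iff matrix_vector_mult_def sum.distrib sum_distrib_left algebra_simps)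

lemma bounded_linear_transpose: "bounded_linear (transpose :: real^'n^'m \<Rightarrow> real^'m^'n)"
  by (auto intro!: linearI simp: linear_conv_bounded_linear[symmetric] vec_eq_iff transpose_def)

lemma matrix_power_Suc2: "matrix_power A (Suc k) = matrix_power A k ** A"
  by (induction k) (simp_all add: matrix_mul_assoc)

lemma transpose_matrix_power: "transpose (matrix_power A k) = matrix_power (transpose A) k"
proof (induction k)
  case (Suc k)
  then show ?case
    by (metis matrix_power.simps(2) matrix_power_Suc2 matrix_transpose_mul)
qed simp

lemma matrix_power_scaleR: "matrix_power (t *\<^sub>R A) k = t ^ k *\<^sub>R matrix_power A k"
  by (induction k) (simp_all add: scalar_matrix_assoc matrix_scalar_ac mult.commute)

text \<open>The norm of a product is bounded only up to the constant of the bounded bilinear map;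
  this constant enters once per factor and is absorbed into \<open>K\<close> together with the norm
  of \<open>A\<close>.\<close>

lemma norm_matrix_power_le:
  obtains K where "\<And>k. norm (matrix_power (A :: real^'k^'k) k) \<le> norm (mat 1 :: real^'k^'k) * K ^ k"
proof -
  obtain K where K: "K > 0" "\<And>(A :: real^'k^'k) (B :: real^'k^'k). norm (A ** B) \<le> norm A * norm B * K"
    using bounded_bilinear.pos_bounded[OF bounded_bilinear_matrix_matrix_mult] by blast
  have "norm (matrix_power A k) \<le> norm (mat 1 :: real^'k^'k) * (norm A * K) ^ k" for k
  proof (induction k)
    case (Suc k)
    have "norm (matrix_power A (Suc k)) \<le> norm A * norm (matrix_power A k) * K"
      using K(2) by simp
    also have "\<dots> \<le> norm A * (norm (mat 1 :: real^'k^'k) * (norm A * K) ^ k) * K"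
      by (intro mult_right_mono mult_left_mono Suc) (use K in auto)
    finally show ?case by (simp add: algebra_simps)
  qed simp
  then show ?thesis using that by blast
qed

lemma summable_matrix_exp: "summable (\<lambda>k. (1 / fact k) *\<^sub>R matrix_power (A :: real^'k^'k) k)"
proof -
  obtain K where K: "\<And>k. norm (matrix_power A k) \<le> norm (mat 1 :: real^'k^'k) * K ^ k"
    using norm_matrix_power_le[of A] by blast
  have "summable (\<lambda>k. norm (mat 1 :: real^'k^'k) * (K ^ k /\<^sub>R fact k))"
    by (intro summable_mult summable_exp_generic)
  then show ?thesis
    by (rule summable_comparison_test') (use K in \<open>auto simp: field_simps\<close>)
qed

lemma transpose_matrix_exp: "transpose (matrix_exp A) = matrix_exp (transpose A)"
  unfolding matrix_exp_def bounded_linear.suminf[OF bounded_linear_transpose summable_matrix_exp]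
  by (simp add: transpose_scalar transpose_matrix_power)

lemma matrix_exp_0 [simp]: "matrix_exp (0 :: real^'k^'k) = mat 1"
proof -
  have "matrix_power (0 :: real^'k^'k) k = (if k = 0 then mat 1 else 0)" for k
    by (cases k) (simp_all add: vec_eq_iff matrix_matrix_mult_def)
  then have "matrix_exp (0 :: real^'k^'k) = (\<Sum>k. if k = 0 then mat 1 else 0)"
    unfolding matrix_exp_def by (intro suminf_cong) simp
  also have "\<dots> = mat 1" using suminf_finite[of "{0::nat}" "\<lambda>k. if k = 0 then (mat 1 :: real^'k^'k) else 0"] by simp
  finally show ?thesis .
qed

lemma matrix_exp_commute: "A ** matrix_exp (t *\<^sub>R A) = matrix_exp (t *\<^sub>R A) ** A"
proof -
  note b = bounded_bilinear.bounded_linear_right[OF bounded_bilinear_matrix_matrix_mult]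
    bounded_bilinear.bounded_linear_left[OF bounded_bilinear_matrix_matrix_mult]
  have "A ** matrix_power A k = matrix_power A k ** A" for k
    using matrix_power_Suc2[of A k] by simp
  then show ?thesis
    unfolding matrix_exp_def bounded_linear.suminf[OF b(1) summable_matrix_exp]
      bounded_linear.suminf[OF b(2) summable_matrix_exp]
    by (simp add: matrix_power_scaleR matrix_scalar_ac flip: scalar_matrix_assoc)
qed

lemma has_vector_derivative_vec_iff:
  fixes f :: "real \<Rightarrow> 'a::euclidean_space^'n"
  shows "(f has_vector_derivative f') (at t within S) \<longleftrightarrow>
    (\<forall>i. ((\<lambda>t. f t $ i) has_vector_derivative f' $ i) (at t within S))"
proof
  assume "\<forall>i. ((\<lambda>t. f t $ i) has_vector_derivative f' $ i) (at t within S)"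
  then show "(f has_vector_derivative f') (at t within S)"
    unfolding has_vector_derivative_def
    by (intro has_derivative_componentwise_within[THEN iffD2])
      (fastforce simp: Basis_vec_def inner_axis dest: has_derivative_inner_left)
qed (auto intro: bounded_linear.has_vector_derivative[OF bounded_linear_vec_nth])

text \<open>Each entry is an everywhere convergent scalar power series in t, so termwise
  differentiation applies. The shift of coefficients by \<open>diffs\<close> cancels one factor of
  the factorial and frees one factor \<open>A\<close>.\<close>

lemma has_vector_derivative_matrix_exp:
  fixes A :: "real^'k^'k"
  shows "((\<lambda>t. matrix_exp (t *\<^sub>R A)) has_vector_derivative A ** matrix_exp (t *\<^sub>R A)) (at t within S)"
proof -
  define c where "c i j n = matrix_power A n $ i $ j / fact n" for i j n
  have sm: "(\<lambda>n. c i j n * t ^ n) sums (matrix_exp (t *\<^sub>R A) $ i $ j)" for i j t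
    using sums_vec_nth[OF sums_vec_nth[OF summable_sums[OF summable_matrix_exp[of "t *\<^sub>R A"]]], of i j]
    by (simp add: matrix_power_scaleR c_def matrix_exp_def mult_ac)
  have "((\<lambda>t. matrix_exp (t *\<^sub>R A) $ i $ j) has_real_derivative (A ** matrix_exp (t *\<^sub>R A)) $ i $ j) (at t)" for i j
  proof -
    have "((\<lambda>t. \<Sum>n. c i j n * t ^ n) has_field_derivative (\<Sum>n. diffs (c i j) n * t ^ n)) (at t)"
      by (rule termdiffs_strong_converges_everywhere) (use sm sums_summable in blast)
    moreover have "diffs (c i j) n * t ^ n = (\<Sum>l\<in>UNIV. A $ i $ l * (c l j n * t ^ n))" for n
    proof -
      have "diffs (c i j) n = matrix_power A (Suc n) $ i $ j / fact n"
        using nonzero_mult_divide_mult_cancel_left[of "1 + real n" "matrix_power A (Suc n) $ i $ j" "fact n"]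
        by (simp add: diffs_def c_def del: matrix_power.simps)
      then have "diffs (c i j) n * t ^ n = (\<Sum>l\<in>UNIV. A $ i $ l * matrix_power A n $ l $ j / fact n * t ^ n)"
        by (simp add: matrix_matrix_mult_def sum_divide_distrib sum_distrib_right)
      also have "\<dots> = (\<Sum>l\<in>UNIV. A $ i $ l * (c l j n * t ^ n))"
        by (rule sum.cong) (simp_all add: c_def)
      finally show ?thesis .
    qed
    moreover have "(\<lambda>n. \<Sum>l\<in>UNIV. A $ i $ l * (c l j n * t ^ n)) sums (A ** matrix_exp (t *\<^sub>R A)) $ i $ j"
      unfolding matrix_matrix_mult_def using sm by (auto intro!: sums_sum sums_mult)
    ultimately show ?thesis
      using sm by (simp add: sums_iff)
  qed
  then have "((\<lambda>t. matrix_exp (t *\<^sub>R A)) has_vector_derivative A ** matrix_exp (t *\<^sub>R A)) (at t)"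
    by (simp add: has_vector_derivative_vec_iff has_real_derivative_iff_has_vector_derivative)
  then show ?thesis by (rule has_vector_derivative_at_within)
qed

section \<open>Linear differential equations: growth bounds and uniqueness\<close>

lemma real_derivative_le_exp:
  fixes f :: "real \<Rightarrow> real"
  assumes d: "\<And>s. s \<ge> 0 \<Longrightarrow> (f has_real_derivative f' s) (at s within {0..})"
    and le: "\<And>s. s \<ge> 0 \<Longrightarrow> f' s \<le> c * f s" and "t \<ge> 0"
  shows "f t \<le> exp (c * t) * f 0"
proof -
  \<comment> \<open>The integrating factor of Gronwall's inequality. The rate \<open>c\<close> is
    used with both signs: positive for uniqueness of solutions, negative for decay of the Lyapunov
    function.\<close>
  define g where "g s = exp (- c * s) * f s" for s
  have g: "(g has_real_derivative exp (- c * s) * (f' s - c * f s)) (at s within {0..})" if "s \<ge> 0" for s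
    unfolding g_def using d[OF that] by (auto intro!: derivative_eq_intros simp: algebra_simps)
  have "g t \<le> g 0"
  proof (rule DERIV_nonpos_imp_decreasing_open[OF \<open>t \<ge> 0\<close>])
    fix s assume "0 < s" "s < t"
    then have "(g has_real_derivative exp (- c * s) * (f' s - c * f s)) (at s)"
      using g[of s] at_within_interior[of s "{0..}"] by (simp add: interior_Ici)
    then show "\<exists>y. (g has_real_derivative y) (at s) \<and> y \<le> 0"
      using le[of s] \<open>0 < s\<close> by (auto intro!: exI mult_nonneg_nonpos)
  next
    have "continuous_on {0..} g"
      using g DERIV_continuous by (fastforce simp: continuous_on_eq_continuous_within)
    then show "continuous_on {0..t} g" by (rule continuous_on_subset) auto
  qed
  then show ?thesis by (simp add: g_def exp_minus field_simps)
qed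

lemma linear_ode_zero:
  fixes A :: "real^'k^'k"
  assumes d: "\<And>t. t \<ge> 0 \<Longrightarrow> (y has_vector_derivative A *v y t) (at t within {0..})"
    and "y 0 = 0" "t \<ge> 0"
  shows "y t = 0"
proof -
  obtain K where K: "K > 0" "\<And>x. norm (A *v x) \<le> norm x * K"
    using bounded_linear.pos_bounded[OF matrix_vector_mul_bounded_linear[of A]] by blast
  \<comment> \<open>The squared norm grows at most at twice the operator bound, so it stays at its
    initial value 0.\<close>
  have "y t \<bullet> y t \<le> exp (2 * K * t) * (y 0 \<bullet> y 0)"
  proof (rule real_derivative_le_exp[where f' = "\<lambda>s. y s \<bullet> (A *v y s) + (A *v y s) \<bullet> y s"])
    fix s :: real assume "s \<ge> 0"
    show "((\<lambda>s. y s \<bullet> y s) has_real_derivative y s \<bullet> (A *v y s) + (A *v y s) \<bullet> y s) (at s within {0..})"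
      unfolding has_real_derivative_iff_has_vector_derivative
      by (rule bounded_bilinear.has_vector_derivative[OF bounded_bilinear_inner d d]) fact+
    have "y s \<bullet> (A *v y s) \<le> norm (y s) * (norm (y s) * K)"
      by (rule order_trans[OF norm_cauchy_schwarz mult_left_mono[OF K(2)]]) simp
    then show "y s \<bullet> (A *v y s) + (A *v y s) \<bullet> y s \<le> 2 * K * (y s \<bullet> y s)"
      by (simp add: inner_commute dot_square_norm power2_eq_square mult_ac)
  qed fact
  with \<open>y 0 = 0\<close> show ?thesis by (metis inner_ge_zero inner_eq_zero_iff inner_zero_left mult_zero_right order_antisym)
qed

lemma linear_ode_unique:
  fixes A :: "real^'k^'k"
  assumes d: "\<And>t. t \<ge> 0 \<Longrightarrow> (x has_vector_derivative A *v x t) (at t within {0..})" and "t \<ge> 0"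
  shows "x t = matrix_exp (t *\<^sub>R A) *v x 0"
proof -
  let ?e = "\<lambda>t. matrix_exp (t *\<^sub>R A) *v x 0"
  have "x t - ?e t = 0"
  proof (rule linear_ode_zero[of "\<lambda>t. x t - ?e t"])
    show "((\<lambda>t. x t - ?e t) has_vector_derivative A *v (x s - ?e s)) (at s within {0..})" if "s \<ge> 0" for s
      by (auto intro!: derivative_eq_intros d that has_vector_derivative_matrix_exp
          bounded_linear.has_vector_derivative[OF bounded_bilinear.bounded_linear_left[OF bounded_bilinear_matrix_vector_mult]]
          simp: matrix_vector_mult_diff_distrib matrix_vector_mul_assoc)
  qed (use \<open>t \<ge> 0\<close> in auto)
  then show ?thesis by simp
qed

lemma has_vector_derivative_matrix_exp_mult:
  fixes A :: "real^'k^'k"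
  shows
  "((\<lambda>t. matrix_exp (t *\<^sub>R A) *v b) has_vector_derivative A *v (matrix_exp (t *\<^sub>R A) *v b)) (at t within S)"
  using bounded_linear.has_vector_derivative[OF bounded_bilinear.bounded_linear_left[OF bounded_bilinear_matrix_vector_mult, of b]
    has_vector_derivative_matrix_exp[of A t S]]
  by (simp add: matrix_vector_mul_assoc)

section \<open>From integral equations to differential equations\<close>

lemma continuous_on_indefinite_integral:
  fixes F :: "real \<Rightarrow> 'a::banach"
  assumes F: "\<And>t. t \<ge> 0 \<Longrightarrow> (f has_integral F t - c) {0..t}"
  shows "continuous_on {0..} F"
proof -
  have "continuous_on {0..b} (\<lambda>t. c + integral {0..t} f)" if "b \<ge> 0" for b
    using F[OF that] by (intro continuous_intros indefinite_integral_continuous_1) (auto simp: integrable_on_def)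
  then have "continuous_on {0..b} F" if "b \<ge> 0" for b
    by (rule continuous_on_eq) (use that in \<open>auto simp: integral_unique[OF F]\<close>)
  then have c: "continuous_on {0..b} F" for b by (cases "b \<ge> 0") auto
  show ?thesis
    unfolding continuous_on_eq_continuous_within
  proof
    fix t :: real assume "t \<in> {0..}"
    \<comment> \<open>An interval reaching beyond t has the same neighbourhood filter at t as the
      half-line.\<close>
    moreover have "at t within {0..t+1} = at t within {0..}"
      using at_within_nhd[of t "{..<t+1}" "{0..t+1}" "{0..}"] by fastforce
    ultimately show "continuous (at t within {0..}) F"
      using c[of "t + 1"] by (auto simp: continuous_on_eq_continuous_within dest!: bspec[of _ _ t])
  qed
qed

lemma has_vector_derivative_indefinite_integral:
  fixes F :: "real \<Rightarrow> 'a::banach"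
  assumes F: "\<And>t. t \<ge> 0 \<Longrightarrow> (f has_integral F t - c) {0..t}"
    and f: "continuous_on {0..} f" and "t \<ge> 0"
  shows "(F has_vector_derivative f t) (at t within {0..})"
proof -
  have "continuous_on {0..t+1} f" by (rule continuous_on_subset[OF f]) auto
  then have "((\<lambda>s. c + integral {0..s} f) has_vector_derivative f t) (at t within {0..t+1})"
    using \<open>t \<ge> 0\<close> by (auto intro!: derivative_eq_intros integral_has_vector_derivative)
  then have "(F has_vector_derivative f t) (at t within {0..t+1})"
    by (rule has_vector_derivative_transform[rotated 2]) (use \<open>t \<ge> 0\<close> in \<open>auto simp: integral_unique[OF F]\<close>)
  moreover have "at t within {0..t+1} = at t within {0..}"
    using at_within_nhd[of t "{..<t+1}" "{0..t+1}" "{0..}"] \<open>t \<ge> 0\<close> by fastforce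
  ultimately show ?thesis by simp
qed

text \<open>The integral equation improves its own solutions: integrability of \<open>A x\<close>
  makes \<open>x\<close> continuous, hence \<open>A x\<close> continuous, hence \<open>x\<close>
  differentiable. The resulting unique solution is what justifies the definite description in
  \<open>impulse_output\<close>.\<close>

lemma state_response_iff:
  "state_response A B (step_signal u) x \<longleftrightarrow>
     x = (\<lambda>t. if t < 0 then 0 else matrix_exp (t *\<^sub>R A) *v (B *v u))" (is "?lhs \<longleftrightarrow> x = ?x")
proof
  assume ?lhs
  have neg: "x t = 0" if "t < 0" for t
    using \<open>?lhs\<close> that by (auto simp: state_response_def)
  have int: "((\<lambda>s. A *v x s) has_integral x t - B *v u) {0..t}" if "t \<ge> 0" for t
    using \<open>?lhs\<close> that by (auto simp: state_response_def step_signal_def)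
  have "continuous_on {0..} (\<lambda>s. A *v x s)"
    by (intro bounded_linear.continuous_on[OF matrix_vector_mul_bounded_linear] continuous_on_indefinite_integral[OF int])
  note d = has_vector_derivative_indefinite_integral[OF int this]
  \<comment> \<open>Over a single point the integral vanishes, so the impulse amounts to the initial
    state \<open>B u\<close>.\<close>
  have "x 0 = B *v u" using has_integral_unique[OF int[of 0]] by fastforce
  show "x = ?x"
    using neg linear_ode_unique[OF d] \<open>x 0 = B *v u\<close> by (auto simp: fun_eq_iff)
next
  assume x: "x = ?x"
  have "((\<lambda>s. A *v x s) has_integral x t - B *v u) {0..t}" if "t \<ge> 0" for t
  proof -
    have "((\<lambda>s. A *v (matrix_exp (s *\<^sub>R A) *v (B *v u))) has_integral
        matrix_exp (t *\<^sub>R A) *v (B *v u) - matrix_exp (0 *\<^sub>R A) *v (B *v u)) {0..t}"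
      by (rule fundamental_theorem_of_calculus[OF that has_vector_derivative_matrix_exp_mult])
    then have "((\<lambda>s. A *v (matrix_exp (s *\<^sub>R A) *v (B *v u))) has_integral x t - B *v u) {0..t}"
      using that by (simp add: x)
    then show ?thesis
      by (rule has_integral_eq[rotated]) (simp add: x)
  qed
  then show ?lhs by (auto simp: state_response_def step_signal_def x)
qed

lemma impulse_output_eq:
  "impulse_output A B C u = (\<lambda>t. if t < 0 then 0 else C *v (matrix_exp (t *\<^sub>R A) *v (B *v u)))"
  unfolding impulse_output_def state_response_iff by auto

section \<open>Gramians of semistable systems\<close>

lemma exp_bounded_imp_absolutely_integrable:
  fixes f :: "real \<Rightarrow> 'a::euclidean_space"
  assumes "continuous_on {0..} f" "l > 0" "\<And>t. t \<ge> 0 \<Longrightarrow> norm (f t) \<le> K * exp (- l * t)"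
  shows "f absolutely_integrable_on {0..}"
proof (rule measurable_bounded_by_integrable_imp_absolutely_integrable)
  show "f \<in> borel_measurable (lebesgue_on {0..})"
    by (rule continuous_imp_measurable_on_sets_lebesgue) (use assms in auto)
  show "(\<lambda>t. K * exp (- l * t)) integrable_on {0..}"
    using integrable_on_cmult_left[OF integrable_on_exp_minus_to_infinity[OF \<open>l > 0\<close>, of 0], of K] by simp
qed (use assms in auto)

text \<open>The fundamental theorem of calculus on a half-line. Absolute integrability allows
  passing to the Lebesgue integral, where truncated integrals converge to the full one.\<close>

lemma integral_derivative_atLeast:
  fixes F :: "real \<Rightarrow> real"
  assumes F: "\<And>t. t \<ge> 0 \<Longrightarrow> (F has_real_derivative f t) (at t within {0..})"
    and f: "f absolutely_integrable_on {0..}" and lim: "(F \<longlongrightarrow> 0) at_top"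
  shows "integral {0..} f = - F 0"
proof -
  have "((\<lambda>b. integral {0..b} f) \<longlongrightarrow> integral {0..} f) at_top"
  proof -
    have "((\<lambda>b. set_lebesgue_integral lebesgue {0..b} f) \<longlongrightarrow> set_lebesgue_integral lebesgue {0..} f) at_top"
      by (rule tendsto_set_lebesgue_integral_at_top) (use f in auto)
    moreover have "f absolutely_integrable_on {0..b}" for b
      by (rule set_integrable_subset[OF f]) auto
    ultimately show ?thesis
      using f by (simp add: set_lebesgue_integral_eq_integral(2))
  qed
  moreover have "((\<lambda>b. integral {0..b} f) \<longlongrightarrow> 0 - F 0) at_top"
  proof (rule Lim_transform_eventually)
    show "((\<lambda>b. F b - F 0) \<longlongrightarrow> 0 - F 0) at_top"
      by (intro tendsto_intros lim)
    show "\<forall>\<^sub>F b in at_top. F b - F 0 = integral {0..b} f"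
      using eventually_ge_at_top[of 0]
    proof eventually_elim
      case (elim b)
      have "(f has_integral F b - F 0) {0..b}"
        by (rule fundamental_theorem_of_calculus[OF elim])
          (auto simp flip: has_real_derivative_iff_has_vector_derivative intro: DERIV_subset[OF F])
      then show ?case by (simp add: integral_unique)
    qed
  qed
  ultimately show ?thesis
    using tendsto_unique[OF trivial_limit_at_top_linorder] by fastforce
qed

lemma exp_decay_tendsto_0:
  fixes f :: "real \<Rightarrow> 'a::real_normed_vector"
  assumes "l > 0" "\<And>t. t \<ge> 0 \<Longrightarrow> norm (f t) \<le> K * exp (- l * t)"
  shows "(f \<longlongrightarrow> 0) at_top"
proof (rule Lim_null_comparison)
  show "\<forall>\<^sub>F t in at_top. norm (f t) \<le> K * exp (- l * t)"
    using eventually_ge_at_top[of 0] by eventually_elim (use assms in auto)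
  show "((\<lambda>t. K * exp (- l * t)) \<longlongrightarrow> 0) at_top"
  proof (intro tendsto_mult_right_zero filterlim_compose[OF exp_at_bot])
    show "LIM t at_top. - l * t :> at_bot"
      by (rule filterlim_tendsto_neg_mult_at_bot[OF tendsto_const _ filterlim_ident]) (use \<open>l > 0\<close> in simp)
  qed
qed

lemma inner_matrix_transpose: "x \<bullet> (transpose M *v y) = (M *v x) \<bullet> (y :: real^'m)" for M :: "real^'n^'m"
  by (metis dot_lmul_matrix inner_commute transpose_matrix_vector)

lemma matrix_diff_ldistrib: "A ** (B - C) = A ** B - A ** (C :: 'a::ring_1^'p^'n)"
  by (simp add: vec_eq_iff matrix_matrix_mult_def right_diff_distrib sum_subtractf)

lemma matrix_diff_rdistrib: "(A - B) ** C = A ** C - B ** (C :: 'a::ring_1^'p^'n)"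
  by (simp add: vec_eq_iff matrix_matrix_mult_def left_diff_distrib sum_subtractf)

lemma matrix_vector_mult_uminus: "(- A) *v x = - (A *v (x :: 'a::ring_1^'n))"
  by (simp add: vec_eq_iff matrix_vector_mult_def sum_negf)

text \<open>The Gramian is accessible only through its bilinear form, so matrix equations are
  verified on pairs of vectors.\<close>

lemma matrix_eq_inner: "(M :: real^'n^'m) = P \<longleftrightarrow> (\<forall>x y. x \<bullet> (M *v y) = x \<bullet> (P *v y))"
  by (auto simp: matrix_eq intro: vector_eq_ldot[THEN iffD1])

lemma inner_gramian_integrand:
  "x \<bullet> (gramian_integrand A C t *v y) =
     (C *v (matrix_exp (t *\<^sub>R A) *v x)) \<bullet> (C *v (matrix_exp (t *\<^sub>R A) *v y))"
proof -
  have "gramian_integrand A C t = transpose (C ** matrix_exp (t *\<^sub>R A)) ** (C ** matrix_exp (t *\<^sub>R A))"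
    by (simp add: gramian_integrand_def matrix_transpose_mul transpose_matrix_exp transpose_scalar matrix_mul_assoc)
  then show ?thesis
    by (simp add: inner_matrix_transpose del: transpose_matrix_vector flip: matrix_vector_mul_assoc)
qed

lemma norm_matrix_le_sum: "norm (M :: real^'n^'m) \<le> (\<Sum>i\<in>UNIV. \<Sum>j\<in>UNIV. \<bar>M $ i $ j\<bar>)"
proof -
  have "norm M \<le> (\<Sum>i\<in>UNIV. norm (M $ i))"
    unfolding norm_vec_def by (rule L2_set_le_sum) simp
  also have "\<dots> \<le> (\<Sum>i\<in>UNIV. \<Sum>j\<in>UNIV. \<bar>M $ i $ j\<bar>)"
    by (intro sum_mono norm_le_l1_cart)
  finally show ?thesis .
qed

text \<open>The matrix exponential tends exponentially to the projection \<open>v w\<^sup>T\<close>, whose range is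
  invisible in the output \<open>C\<close>.\<close>

locale semistable_system =
  fixes A :: "real^'k^'k" and C :: "real^'k^'m" and v w :: "real^'k" and K l :: real
  assumes rate: "l > 0"
    and decay: "t \<ge> 0 \<Longrightarrow> norm (matrix_exp (t *\<^sub>R A) *v x - (w \<bullet> x) *\<^sub>R v) \<le> K * exp (- l * t) * norm x"
    and A_v: "A *v v = 0" and C_v: "C *v v = 0"
begin

definition out :: "real^'k \<Rightarrow> real \<Rightarrow> real^'m" where
  "out x t = C *v (matrix_exp (t *\<^sub>R A) *v x)"

lemma matrix_exp_v: "t \<ge> 0 \<Longrightarrow> matrix_exp (t *\<^sub>R A) *v v = v"
  using linear_ode_unique[of "\<lambda>_. v" A t] by (simp add: A_v)

lemma tendsto_matrix_exp: "((\<lambda>t. matrix_exp (t *\<^sub>R A) *v x) \<longlongrightarrow> (w \<bullet> x) *\<^sub>R v) at_top"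
proof -
  have "((\<lambda>t. matrix_exp (t *\<^sub>R A) *v x - (w \<bullet> x) *\<^sub>R v) \<longlongrightarrow> 0) at_top"
    by (rule exp_decay_tendsto_0[OF rate, where K = "K * norm x"]) (use decay[of _ x] in \<open>simp add: mult_ac\<close>)
  then show ?thesis by (simp add: LIM_zero_iff)
qed

text \<open>The state need not decay, but subtracting its limit, a multiple of \<open>v\<close>,
  does not change the output since \<open>C\<close> annihilates \<open>v\<close>.\<close>

lemma out_bound: obtains K' where "\<And>t. t \<ge> 0 \<Longrightarrow> norm (out x t) \<le> K' * exp (- l * t)"
proof -
  obtain c where c: "c > 0" "\<And>x. norm (C *v x) \<le> norm x * c"
    using bounded_linear.pos_bounded[OF matrix_vector_mul_bounded_linear[of C]] by blast
  have "norm (out x t) \<le> K * norm x * c * exp (- l * t)" if "t \<ge> 0" for t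
  proof -
    have "out x t = C *v (matrix_exp (t *\<^sub>R A) *v x - (w \<bullet> x) *\<^sub>R v)"
      by (simp add: out_def matrix_vector_mult_diff_distrib matrix_vector_mult_scaleR C_v)
    also have "norm \<dots> \<le> K * exp (- l * t) * norm x * c"
      by (rule order_trans[OF c(2) mult_right_mono[OF decay[OF that]]]) (use c in simp)
    finally show ?thesis by (simp add: mult_ac)
  qed
  then show ?thesis using that by blast
qed

text \<open>The exponential commutes with \<open>A\<close>, so differentiating in time amounts to
  replacing the initial state \<open>x\<close> by \<open>A x\<close>. This turns the left side of
  the Lyapunov equation into a time derivative.\<close>

lemma has_vector_derivative_out: "(out x has_vector_derivative out (A *v x) t) (at t within S)"
proof -
  have "A *v (matrix_exp (t *\<^sub>R A) *v x) = matrix_exp (t *\<^sub>R A) *v (A *v x)"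
    by (simp add: matrix_vector_mul_assoc matrix_exp_commute)
  then show ?thesis
    using bounded_linear.has_vector_derivative[OF matrix_vector_mul_bounded_linear[of C]
      has_vector_derivative_matrix_exp_mult[of A x t S]]
    unfolding out_def by simp
qed

lemma continuous_on_out [continuous_intros]: "continuous_on S (out x)"
  using has_vector_derivative_out has_vector_derivative_continuous
  by (fastforce simp: continuous_on_eq_continuous_within)

lemma out_inner_bound: obtains K' where "\<And>t. t \<ge> 0 \<Longrightarrow> \<bar>out x t \<bullet> out y t\<bar> \<le> K' * exp (- (2 * l) * t)"
proof -
  obtain K1 K2 where K: "\<And>t. t \<ge> 0 \<Longrightarrow> norm (out x t) \<le> K1 * exp (- l * t)"
    "\<And>t. t \<ge> 0 \<Longrightarrow> norm (out y t) \<le> K2 * exp (- l * t)"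
    using out_bound[of x] out_bound[of y] by metis
  have "\<bar>out x t \<bullet> out y t\<bar> \<le> K1 * K2 * exp (- (2 * l) * t)" if "t \<ge> 0" for t
  proof -
    have "\<bar>out x t \<bullet> out y t\<bar> \<le> norm (out x t) * norm (out y t)"
      by (rule Cauchy_Schwarz_ineq2)
    also have "\<dots> \<le> (K1 * exp (- l * t)) * (K2 * exp (- l * t))"
      by (rule mult_mono'[OF K[OF that]]) auto
    also have "\<dots> = K1 * K2 * exp (- (2 * l) * t)"
      by (simp flip: exp_add)
    finally show ?thesis .
  qed
  then show ?thesis using that by blast
qed

lemma out_inner_absolutely_integrable: "(\<lambda>t. out x t \<bullet> out y t) absolutely_integrable_on {0..}"
proof -
  obtain K' where "\<And>t. t \<ge> 0 \<Longrightarrow> \<bar>out x t \<bullet> out y t\<bar> \<le> K' * exp (- (2 * l) * t)"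
    using out_inner_bound by blast
  then show ?thesis
    by (intro exp_bounded_imp_absolutely_integrable[of _ "2 * l"] continuous_intros) (use rate in auto)
qed

lemma gramian_integrand_integrable: "gramian_integrand A C integrable_on {0..}"
proof -
  have e: "gramian_integrand A C t $ i $ j = out (axis i 1) t \<bullet> out (axis j 1) t" for i j t
    using inner_gramian_integrand[of "axis i 1" A C t "axis j 1"]
    by (simp add: out_def inner_axis' matrix_vector_mult_basis column_def)
  have "\<exists>K'. \<forall>t\<ge>0. \<bar>gramian_integrand A C t $ i $ j\<bar> \<le> K' * exp (- (2 * l) * t)" for i j
    unfolding e using out_inner_bound by metis
  then obtain K' where K': "\<And>i j t. t \<ge> 0 \<Longrightarrow> \<bar>gramian_integrand A C t $ i $ j\<bar> \<le> K' i j * exp (- (2 * l) * t)"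
    by metis
  have "norm (gramian_integrand A C t) \<le> (\<Sum>i\<in>UNIV. \<Sum>j\<in>UNIV. K' i j) * exp (- (2 * l) * t)" if "t \<ge> 0" for t
    unfolding sum_distrib_right
    by (intro order_trans[OF norm_matrix_le_sum] sum_mono K' that)
  moreover have "continuous_on {0..} (gramian_integrand A C)"
  proof -
    have "gramian_integrand A C = (\<lambda>t. \<chi> i j. out (axis i 1) t \<bullet> out (axis j 1) t)"
      by (simp add: fun_eq_iff vec_eq_iff e)
    then show ?thesis by (simp add: continuous_intros)
  qed
  ultimately have "gramian_integrand A C absolutely_integrable_on {0..}"
    by (intro exp_bounded_imp_absolutely_integrable[of _ "2 * l"]) (use rate in auto)
  then show ?thesis using absolutely_integrable_on_def by blast
qed

text \<open>Evaluating a matrix as a bilinear form at fixed vectors is a bounded linear functional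
  and hence passes through the matrix-valued integral.\<close>

lemma inner_gramian: "x \<bullet> (observability_gramian A C *v y) = integral {0..} (\<lambda>t. out x t \<bullet> out y t)"
proof -
  have "bounded_linear (\<lambda>M :: real^'k^'k. x \<bullet> (M *v y))"
    by (intro bounded_linear_intros bounded_linear_compose[OF bounded_linear_inner_right]
        bounded_bilinear.bounded_linear_left[OF bounded_bilinear_matrix_vector_mult])
  from integral_linear[OF gramian_integrand_integrable this] show ?thesis
    by (simp add: observability_gramian_def o_def inner_gramian_integrand out_def)
qed

text \<open>As a form, the left side is the integral of the derivative of
  \<open>out x t \<bullet> out y t\<close>. That product starts at the inner product of
  \<open>C x\<close> and \<open>C y\<close> and tends to 0.\<close>

lemma gramian_lyapunov:
  "transpose A ** observability_gramian A C + observability_gramian A C ** A = - (transpose C ** C)"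
  unfolding matrix_eq_inner
proof (intro allI)
  fix x y
  let ?X = "observability_gramian A C"
  let ?f = "\<lambda>t. out x t \<bullet> out (A *v y) t + out (A *v x) t \<bullet> out y t"
  have ai: "?f absolutely_integrable_on {0..}"
    by (intro set_integral_add out_inner_absolutely_integrable)
  obtain K' where K': "\<And>t. t \<ge> 0 \<Longrightarrow> \<bar>out x t \<bullet> out y t\<bar> \<le> K' * exp (- (2 * l) * t)"
    using out_inner_bound by blast
  have "integral {0..} ?f = - (out x 0 \<bullet> out y 0)"
  proof (rule integral_derivative_atLeast[OF _ ai])
    show "((\<lambda>t. out x t \<bullet> out y t) has_real_derivative ?f t) (at t within {0..})" for t
      unfolding has_real_derivative_iff_has_vector_derivative
      by (rule bounded_bilinear.has_vector_derivative[OF bounded_bilinear_inner]) (rule has_vector_derivative_out)+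
    show "((\<lambda>t. out x t \<bullet> out y t) \<longlongrightarrow> 0) at_top"
      by (rule exp_decay_tendsto_0[of "2 * l" _ K']) (use rate K' in auto)
  qed
  moreover have "integral {0..} ?f = x \<bullet> (?X *v (A *v y)) + (A *v x) \<bullet> (?X *v y)"
    unfolding inner_gramian
    by (intro integral_add) (use out_inner_absolutely_integrable absolutely_integrable_on_def in blast)+
  ultimately show "x \<bullet> ((transpose A ** ?X + ?X ** A) *v y) = x \<bullet> ((- (transpose C ** C)) *v y)"
    by (simp add: matrix_vector_mult_add_rdistrib inner_add_right out_def inner_matrix_transpose
        matrix_vector_mult_uminus flip: matrix_vector_mul_assoc del: transpose_matrix_vector)
qed

lemma out_v: "t \<ge> 0 \<Longrightarrow> out v t = 0"
  by (simp add: out_def matrix_exp_v C_v)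

lemma gramian_v: "observability_gramian A C *v v = 0"
proof -
  have "x \<bullet> (observability_gramian A C *v v) = 0" for x
    unfolding inner_gramian by (rule integral_unique[OF has_integral_is_0]) (simp add: out_v)
  then show ?thesis by (metis inner_eq_zero_iff)
qed

text \<open>The form \<open>x \<bullet> Z y\<close> of the difference \<open>Z\<close> of two solutions is constant along trajectories, which
  tend to multiples of \<open>v\<close>.\<close>

lemma lyapunov_unique:
  assumes Y: "transpose A ** Y + Y ** A = - (transpose C ** C)" "Y *v v = 0"
  shows "Y = observability_gramian A C"
proof -
  define Z where "Z = Y - observability_gramian A C"
  have Zv: "Z *v v = 0"
    by (simp add: Z_def matrix_vector_mult_diff_rdistrib Y gramian_v)
  have "transpose A ** Z + Z ** A = 0"
    using Y(1) gramian_lyapunov by (simp add: Z_def matrix_diff_ldistrib matrix_diff_rdistrib algebra_simps)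
  then have "a \<bullet> ((transpose A ** Z + Z ** A) *v b) = 0" for a b
    by simp
  then have Z: "(A *v a) \<bullet> (Z *v b) + a \<bullet> (Z *v (A *v b)) = 0" for a b
    by (simp add: matrix_vector_mult_add_rdistrib inner_add_right inner_matrix_transpose
        del: transpose_matrix_vector flip: matrix_vector_mul_assoc)
  have "x \<bullet> (Z *v y) = 0" for x y
  proof -
    let ?E = "\<lambda>x t. matrix_exp (t *\<^sub>R A) *v x"
    let ?f = "\<lambda>t. ?E x t \<bullet> (Z *v ?E y t)"
    have "(?f has_vector_derivative 0) (at t)" for t
    proof -
      have "(?f has_vector_derivative ?E x t \<bullet> (Z *v (A *v ?E y t)) + (A *v ?E x t) \<bullet> (Z *v ?E y t)) (at t)"
        by (rule bounded_bilinear.has_vector_derivative[OF bounded_bilinear_inner has_vector_derivative_matrix_exp_mult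
              bounded_linear.has_vector_derivative[OF matrix_vector_mul_bounded_linear has_vector_derivative_matrix_exp_mult]])
      then show ?thesis using Z by (simp add: add.commute)
    qed
    then obtain c where "?f t = c" for t
      using has_vector_derivative_zero_constant[of UNIV ?f] by auto
    then have "?f t = ?f 0" for t by metis
    then have "(?f \<longlongrightarrow> x \<bullet> (Z *v y)) at_top"
      by simp
    moreover have "(?f \<longlongrightarrow> ((w \<bullet> x) *\<^sub>R v) \<bullet> (Z *v ((w \<bullet> y) *\<^sub>R v))) at_top"
      by (intro tendsto_intros tendsto_matrix_exp bounded_linear.tendsto[OF matrix_vector_mul_bounded_linear])
    ultimately show ?thesis
      using tendsto_unique[OF trivial_limit_at_top_linorder] by (fastforce simp: matrix_vector_mult_scaleR Zv)
  qed
  then have "Z = 0" by (simp add: matrix_eq_inner)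
  then show ?thesis by (simp add: Z_def)
qed

lemma impulse_output_out: "t \<ge> 0 \<Longrightarrow> impulse_output A B C u t = out (B *v u) t"
  by (simp add: impulse_output_eq out_def)

lemma impulse_output_energy:
  "(\<lambda>t. (norm (impulse_output A B C u t))\<^sup>2) integrable_on {0..}"
  "l2_norm_sq (impulse_output A B C u) = (B *v u) \<bullet> (observability_gramian A C *v (B *v u))"
proof -
  have e: "(norm (impulse_output A B C u t))\<^sup>2 = out (B *v u) t \<bullet> out (B *v u) t" if "t \<in> {0..}" for t
    using that by (simp add: impulse_output_out dot_square_norm)
  have "(\<lambda>t. out (B *v u) t \<bullet> out (B *v u) t) integrable_on {0..}"
    using out_inner_absolutely_integrable absolutely_integrable_on_def by blast
  then show "(\<lambda>t. (norm (impulse_output A B C u t))\<^sup>2) integrable_on {0..}"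
    by (rule integrable_eq) (simp add: e)
  show "l2_norm_sq (impulse_output A B C u) = (B *v u) \<bullet> (observability_gramian A C *v (B *v u))"
    unfolding l2_norm_sq_def inner_gramian by (rule integral_cong) (rule e)
qed

text \<open>Applied with \<open>c = - \<Delta>P\<close>: the sign of the disturbances disappears in
  the square.\<close>

lemma l2_norm_sq_scaleR:
  "l2_norm_sq (impulse_output A B C (c *\<^sub>R u)) = c\<^sup>2 * l2_norm_sq (impulse_output A B C u)"
  by (simp add: impulse_output_energy(2) matrix_vector_mult_scaleR power2_eq_square)

lemma h2_norm_sq_eq_trace:
  fixes B :: "real^'n^'k"
  shows "h2_norm_sq A B C = trace (transpose B ** observability_gramian A C ** B)"
proof -
  have "(transpose B ** observability_gramian A C ** B) $ i $ i =
      (B *v axis i 1) \<bullet> (observability_gramian A C *v (B *v axis i 1))" for i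
  proof -
    have "M $ i $ i = axis i 1 \<bullet> (M *v axis i 1)" for M :: "real^'n^'n"
      by (simp add: inner_axis' matrix_vector_mult_basis column_def)
    then show ?thesis
      by (simp add: inner_matrix_transpose flip: matrix_vector_mul_assoc del: transpose_matrix_vector)
  qed
  then show ?thesis by (simp add: h2_norm_sq_def impulse_output_energy(2) trace_def)
qed

end

section \<open>A strict Lyapunov function for the swing dynamics\<close>

lemma inner_diag_matrix: "x \<bullet> (diag_matrix f *v y) = (\<Sum>i\<in>UNIV. f i * x $ i * y $ i)"
  by (simp add: inner_vec_def diag_matrix_def matrix_vector_mult_def if_distrib[of "\<lambda>x. x * _"] cong: if_cong)
     (simp add: mult_ac)

lemma diag_matrix_vector_mult: "diag_matrix f *v y = (\<chi> i. f i * y $ i)"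
  by (simp add: vec_eq_iff diag_matrix_def matrix_vector_mult_def if_distrib[of "\<lambda>x. x * _"] cong: if_cong)

section \<open>Homogeneous functions of degree two between multiples of the squared norm\<close>

lemma quadratic_form_lower_bound:
  fixes f :: "'a::euclidean_space \<Rightarrow> real"
  assumes f: "continuous_on UNIV f" "\<And>c x. f (c *\<^sub>R x) = c\<^sup>2 * f x" "\<And>x. x \<noteq> 0 \<Longrightarrow> f x > 0"
  obtains e where "e > 0" "\<And>x. e * (norm x)\<^sup>2 \<le> f x"
proof -
  \<comment> \<open>The extremum over the compact unit sphere serves as the constant; homogeneity
    carries the bound to all vectors.\<close>
  have "\<exists>x\<in>sphere 0 1. \<forall>y\<in>sphere (0::'a) 1. f x \<le> f y"
    by (rule continuous_attains_inf) (use f(1) continuous_on_subset in auto)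
  then obtain x where x: "norm x = 1" "\<And>y. norm y = 1 \<Longrightarrow> f x \<le> f y"
    by auto
  have "f x * (norm y)\<^sup>2 \<le> f y" for y
  proof (cases "y = 0")
    case True
    then show ?thesis using f(2)[of 0 0] by simp
  next
    case False
    have "f x \<le> f (inverse (norm y) *\<^sub>R y)" using False by (intro x(2)) simp
    then show ?thesis using False by (simp add: f(2) field_simps)
  qed
  moreover have "f x > 0" by (rule f(3)) (use x(1) in auto)
  ultimately show ?thesis using that by blast
qed

lemma quadratic_form_upper_bound:
  fixes f :: "'a::euclidean_space \<Rightarrow> real"
  assumes f: "continuous_on UNIV f" "\<And>c x. f (c *\<^sub>R x) = c\<^sup>2 * f x"
  obtains K where "K > 0" "\<And>x. f x \<le> K * (norm x)\<^sup>2"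
proof -
  have "\<exists>x\<in>sphere 0 1. \<forall>y\<in>sphere (0::'a) 1. f y \<le> f x"
    by (rule continuous_attains_sup) (use f(1) continuous_on_subset in auto)
  then obtain x where x: "norm x = 1" "\<And>y. norm y = 1 \<Longrightarrow> f y \<le> f x"
    by auto
  \<comment> \<open>The maximum with 1 keeps the constant positive even when \<open>f\<close> is
    nonpositive; the constants are later used as divisors.\<close>
  have "f y \<le> max 1 (f x) * (norm y)\<^sup>2" for y
  proof (cases "y = 0")
    case True
    then show ?thesis using f(2)[of 0 0] by simp
  next
    case False
    have "f (inverse (norm y) *\<^sub>R y) \<le> f x" using False by (intro x(2)) simp
    then have "f y \<le> f x * (norm y)\<^sup>2" using False by (simp add: f(2) field_simps)
    also have "\<dots> \<le> max 1 (f x) * (norm y)\<^sup>2" by (intro mult_right_mono) auto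
    finally show ?thesis .
  qed
  then show ?thesis using that[of "max 1 (f x)"] by auto
qed

text \<open>One locale covers both kinds of buses, which differ only in the sign of
  \<open>r\<close>: droop coefficients at generators, negated controller gains at inverters.
  \<open>L_ker\<close> expresses connectedness of the graph.\<close>

locale swing_network =
  fixes m d \<tau> r :: "'n::finite \<Rightarrow> real" and L :: "real^'n^'n"
  assumes m_pos: "m i > 0" and d_pos: "d i > 0" and \<tau>_pos: "\<tau> i > 0"
    and droop: "d i + r i > 0" and sum_r: "(\<Sum>i\<in>UNIV. r i) = 0"
    and L_sym: "x \<bullet> (L *v y) = (L *v x) \<bullet> y" and L_one: "L *v vec 1 = 0"
    and L_nonneg: "x \<bullet> (L *v x) \<ge> 0"
    and L_ker: "x \<bullet> (L *v x) = 0 \<Longrightarrow> \<exists>c. x = c *\<^sub>R vec 1"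
begin

text \<open>The all-ones matrix acts on exactly the line that \<open>L\<close> annihilates, so the
  sum is positive definite and has a genuine inverse.\<close>

definition L1 :: "real^'n^'n" where "L1 = L + (\<chi> i j. 1)"

text \<open>On vectors with sum 0, \<open>J\<close> inverts \<open>L\<close>.\<close>

definition J :: "real^'n^'n" where "J = matrix_inv L1"

text \<open>Weighting the internal states by \<open>k\<close> makes the power balance a sum of squares for every
  \<open>r > - d\<close>, in particular for the negative \<open>r\<close> of the inverters.\<close>

definition k :: "'n \<Rightarrow> real" where "k i = 1 / (2 * d i + r i)"

lemma k_pos: "k i > 0"
  using d_pos[of i] droop[of i] by (simp add: k_def)

lemma L1_mult: "L1 *v x = L *v x + (vec 1 \<bullet> x) *\<^sub>R vec 1"
  by (simp add: L1_def matrix_vector_mult_add_rdistrib vec_eq_iff)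
     (simp add: matrix_vector_mult_def inner_vec_def)

lemma L1_pos: "x \<noteq> 0 \<Longrightarrow> x \<bullet> (L1 *v x) > 0"
proof -
  assume "x \<noteq> 0"
  have e: "x \<bullet> (L1 *v x) = x \<bullet> (L *v x) + (vec 1 \<bullet> x)\<^sup>2"
    by (simp add: L1_mult inner_add_right power2_eq_square inner_commute)
  have "x \<bullet> (L1 *v x) \<noteq> 0"
  proof
    assume "x \<bullet> (L1 *v x) = 0"
    then have "x \<bullet> (L *v x) = 0 \<and> (vec 1 \<bullet> x)\<^sup>2 = 0"
      using e L_nonneg[of x] by (metis add_nonneg_eq_0_iff zero_le_power2)
    then have "x \<bullet> (L *v x) = 0" "vec 1 \<bullet> x = 0" by simp_all
    then obtain c where c: "x = c *\<^sub>R vec 1" using L_ker by blast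
    have "vec 1 \<bullet> (vec 1 :: real^'n) = real CARD('n)" by (simp add: inner_vec_def)
    then have "c = 0" using \<open>vec 1 \<bullet> x = 0\<close> by (simp add: c)
    then show False using c \<open>x \<noteq> 0\<close> by simp
  qed
  moreover have "x \<bullet> (L1 *v x) \<ge> 0" using e L_nonneg[of x] by simp
  ultimately show ?thesis by simp
qed

lemma L1_J: "L1 *v (J *v x) = x" and J_L1: "J *v (L1 *v x) = x"
proof -
  have "inj ((*v) L1)"
    unfolding vec.inj_iff_eq_0 using L1_pos by (metis inner_zero_right less_irrefl)
  then have "invertible L1"
    using invertible_left_inverse matrix_left_invertible_injective by blast
  then have "L1 ** J = mat 1 \<and> J ** L1 = mat 1"
    unfolding J_def matrix_inv_def invertible_def by (rule someI_ex)
  then show "L1 *v (J *v x) = x" "J *v (L1 *v x) = x"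
    by (simp_all add: matrix_vector_mul_assoc)
qed

lemma J_sym: "x \<bullet> (J *v y) = (J *v x) \<bullet> y"
proof -
  have L1_sym: "a \<bullet> (L1 *v b) = (L1 *v a) \<bullet> b" for a b
    using L_sym[of a b] inner_commute[of a "vec 1"] by (simp add: L1_mult inner_add_left inner_add_right)
  show ?thesis using L1_sym[of "J *v x" "J *v y"] by (simp add: L1_J)
qed

lemma J_pos: "x \<noteq> 0 \<Longrightarrow> x \<bullet> (J *v x) > 0"
proof -
  assume "x \<noteq> 0"
  then have "J *v x \<noteq> 0" using L1_J[of x] by auto
  from L1_pos[OF this] show ?thesis by (simp add: L1_J inner_commute)
qed

text \<open>\<open>L1\<close> multiplies the all-ones vector by the number of buses, so
  \<open>J\<close> maps it to a multiple of itself, which is orthogonal to \<open>u\<close>. The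
  correction that distinguishes \<open>L\<close> from \<open>L1\<close> therefore drops out.\<close>

lemma J_L: "vec 1 \<bullet> u = 0 \<Longrightarrow> u \<bullet> (J *v (L *v w)) = u \<bullet> w"
proof -
  assume u: "vec 1 \<bullet> u = 0"
  have "J *v (L1 *v vec 1) = vec 1" by (rule J_L1)
  then have "real CARD('n) *\<^sub>R (J *v vec 1) = vec 1"
    by (simp add: L1_mult L_one[simplified] matrix_vector_mult_scaleR inner_vec_def)
  then have "real CARD('n) * (u \<bullet> (J *v vec 1)) = 0"
    using u by (metis inner_commute inner_scaleR_right)
  then have "u \<bullet> (J *v vec 1) = 0" by simp
  moreover have "L *v w = L1 *v w - (vec 1 \<bullet> w) *\<^sub>R vec 1" by (simp add: L1_mult)
  ultimately show ?thesis
    by (simp add: matrix_vector_mult_diff_distrib matrix_vector_mult_scaleR inner_diff_right J_L1)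
qed

text \<open>If u = - L \<theta>, the first summand is \<theta>^T L \<theta>, the potential energy of
  the lines written without angles. The others are the kinetic energy and the storage of the
  internal states.\<close>

definition energy :: "(real^'n) \<times> (real^'n) \<times> (real^'n) \<Rightarrow> real" where
  "energy = (\<lambda>(w, u, q). (u \<bullet> (J *v u) + w \<bullet> (diag_matrix m *v w) + q \<bullet> (diag_matrix (\<lambda>i. \<tau> i * k i) *v q)) / 2)"

text \<open>Chosen because its derivative contains \<open>u \<bullet> u\<close>, the square absent
  from \<open>dissipation\<close>.\<close>

definition cross :: "(real^'n) \<times> (real^'n) \<times> (real^'n) \<Rightarrow> real" where
  "cross = (\<lambda>(w, u, q). u \<bullet> (diag_matrix m *v w))"

definition dissipation :: "(real^'n) \<times> (real^'n) \<Rightarrow> real" where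
  "dissipation = (\<lambda>(w, q). \<Sum>i\<in>UNIV. k i * ((q $ i - d i * w $ i)\<^sup>2 + d i * (d i + r i) * (w $ i)\<^sup>2))"

lemma diag_matrix_pos: "(\<And>i. f i > 0) \<Longrightarrow> x \<noteq> 0 \<Longrightarrow> x \<bullet> (diag_matrix f *v x) > 0"
proof -
  assume f: "\<And>i. f i > 0" and "x \<noteq> 0"
  then obtain i where "x $ i \<noteq> 0" by (auto simp: vec_eq_iff)
  then show ?thesis
    unfolding inner_diag_matrix using f
    by (intro sum_pos2[of _ i]) (auto simp: mult.assoc less_imp_le zero_less_mult_iff linorder_neq_iff)
qed

lemma energy_pos: "y \<noteq> 0 \<Longrightarrow> energy y > 0"
proof -
  assume "y \<noteq> 0"
  obtain w u q where y: "y = (w, u, q)" by (metis prod.exhaust)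
  have "x \<bullet> (J *v x) \<ge> 0" "x \<bullet> (diag_matrix m *v x) \<ge> 0" "x \<bullet> (diag_matrix (\<lambda>i. \<tau> i * k i) *v x) \<ge> 0" for x
    using J_pos[of x] diag_matrix_pos[of m x] diag_matrix_pos[of "\<lambda>i. \<tau> i * k i" x] m_pos \<tau>_pos k_pos
    by (cases "x = 0"; simp add: less_imp_le)+
  moreover have "w \<noteq> 0 \<or> u \<noteq> 0 \<or> q \<noteq> 0" using \<open>y \<noteq> 0\<close> y by (auto simp: zero_prod_def)
  ultimately show ?thesis
    using J_pos[of u] diag_matrix_pos[of m w] diag_matrix_pos[of "\<lambda>i. \<tau> i * k i" q] m_pos \<tau>_pos k_pos
    by (auto simp: energy_def y add_pos_nonneg add_nonneg_pos)
qed

lemma dissipation_pos: "y \<noteq> 0 \<Longrightarrow> dissipation y > 0"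
proof -
  assume "y \<noteq> 0"
  obtain w q where y: "y = (w, q)" by (metis prod.exhaust)
  have nn: "d i * (d i + r i) > 0" for i using d_pos droop by simp
  from \<open>y \<noteq> 0\<close> obtain i where i: "w $ i \<noteq> 0 \<or> q $ i \<noteq> 0"
    by (auto simp: y zero_prod_def vec_eq_iff)
  show ?thesis unfolding dissipation_def y prod.case
  proof (rule sum_pos2[of _ i])
    show "0 < k i * ((q $ i - d i * w $ i)\<^sup>2 + d i * (d i + r i) * (w $ i)\<^sup>2)"
    proof (cases "w $ i = 0")
      case True
      then show ?thesis using i k_pos by simp
    next
      case False
      then show ?thesis using nn[of i] k_pos[of i]
        by (intro mult_pos_pos[of "k i"] add_nonneg_pos mult_pos_pos[of "d i * (d i + r i)"]) auto
    qed
    show "0 \<le> k j * ((q $ j - d j * w $ j)\<^sup>2 + d j * (d j + r j) * (w $ j)\<^sup>2)" for j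
      using nn[of j] k_pos[of j]
      by (intro mult_nonneg_nonneg[of "k j"] add_nonneg_nonneg mult_nonneg_nonneg[of "d j * (d j + r j)"])
        (auto intro: less_imp_le)
  qed auto
qed

text \<open>Per bus this is - d w^2 + (1 - k r) w q - k q^2, negative definite iff (1 - k r)^2 < 4 k
  d. The chosen \<open>k\<close> makes the mixed coefficient 2 d k, and completing the square leaves
  d (d + r) w^2 with weight k, positive by \<open>droop\<close>.\<close>

lemma energy_identity:
  "(\<Sum>i\<in>UNIV. w $ i * (- d i * w $ i + q $ i) + k i * q $ i * (- r i * w $ i - q $ i)) = - dissipation (w, q)"
  unfolding dissipation_def prod.case sum_negf[symmetric]
proof (rule sum.cong[OF refl])
  fix i
  have "2 * d i + r i \<noteq> 0" using d_pos[of i] droop[of i] by simp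
  then have K: "k i * (2 * d i + r i) = 1" by (simp add: k_def)
  then have k: "d i = d i * (k i * (2 * d i + r i))" "1 - k i * r i = 2 * d i * k i"
    by (simp, simp add: algebra_simps)
  have "w $ i * (- d i * w $ i + q $ i) + k i * q $ i * (- r i * w $ i - q $ i) =
    - d i * (w $ i)\<^sup>2 + (1 - k i * r i) * q $ i * w $ i - k i * (q $ i)\<^sup>2"
    by (simp add: power2_eq_square algebra_simps)
  also have "\<dots> = - (d i * (k i * (2 * d i + r i))) * (w $ i)\<^sup>2 + (2 * d i * k i) * q $ i * w $ i - k i * (q $ i)\<^sup>2"
    unfolding k(2) K by simp
  also have "\<dots> = - (k i * ((q $ i - d i * w $ i)\<^sup>2 + d i * (d i + r i) * (w $ i)\<^sup>2))"
    by (simp add: power2_eq_square algebra_simps)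
  finally show "w $ i * (- d i * w $ i + q $ i) + k i * q $ i * (- r i * w $ i - q $ i) =
    - (k i * ((q $ i - d i * w $ i)\<^sup>2 + d i * (d i + r i) * (w $ i)\<^sup>2))" .
qed

section \<open>Energy balance and decay along trajectories\<close>

definition trajectory :: "(real \<Rightarrow> real^'n) \<Rightarrow> (real \<Rightarrow> real^'n) \<Rightarrow> (real \<Rightarrow> real^'n) \<Rightarrow> bool" where
  "trajectory w u q \<longleftrightarrow> (\<forall>t\<ge>0.
     (w has_vector_derivative (\<chi> i. (u t $ i - d i * w t $ i + q t $ i) / m i)) (at t within {0..}) \<and>
     (u has_vector_derivative - (L *v w t)) (at t within {0..}) \<and>
     (q has_vector_derivative (\<chi> i. (- r i * w t $ i - q t $ i) / \<tau> i)) (at t within {0..}))"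

lemma trajectory_conserved:
  assumes "trajectory w u q" "t \<ge> 0"
  shows "vec 1 \<bullet> u t = vec 1 \<bullet> u 0"
proof -
  have "((\<lambda>t. vec 1 \<bullet> u t) has_real_derivative 0) (at s within {0..})" if "s \<ge> 0" for s
  proof -
    have "((\<lambda>t. vec 1 \<bullet> u t) has_real_derivative vec 1 \<bullet> - (L *v w s)) (at s within {0..})"
      unfolding has_real_derivative_iff_has_vector_derivative
      by (rule bounded_linear.has_vector_derivative[OF bounded_linear_inner_right])
        (use assms that in \<open>simp add: trajectory_def\<close>)
    then show ?thesis by (simp add: L_sym L_one[simplified])
  qed
  then obtain c where "\<And>s. s \<in> {0..} \<Longrightarrow> vec 1 \<bullet> u s = c"
    using has_field_derivative_zero_constant[of "{0..}" "\<lambda>t. vec 1 \<bullet> u t"] by auto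
  then show ?thesis using \<open>t \<ge> 0\<close> by simp
qed

text \<open>The exchange between lines and rotors is lossless: the line term contributes minus
  \<open>u \<bullet> w\<close>, the kinetic term the same with opposite sign. The first holds
  because \<open>J\<close> undoes \<open>L\<close> when tested against a \<open>u\<close> of sum
  0.\<close>

lemma energy_derivative:
  assumes T: "trajectory w u q" and "t \<ge> 0" and u: "vec 1 \<bullet> u t = 0"
  shows "((\<lambda>t. energy (w t, u t, q t)) has_real_derivative - dissipation (w t, q t)) (at t within {0..})"
proof -
  have der: "((\<lambda>t. f t \<bullet> (Q *v f t)) has_real_derivative 2 * (f t \<bullet> (Q *v f'))) (at t within {0..})"
    if f: "(f has_vector_derivative f') (at t within {0..})" and Q: "\<And>x y. x \<bullet> (Q *v y) = (Q *v x) \<bullet> y"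
    for f :: "real \<Rightarrow> real^'n" and f' Q
  proof -
    have "((\<lambda>t. f t \<bullet> (Q *v f t)) has_real_derivative f t \<bullet> (Q *v f') + f' \<bullet> (Q *v f t)) (at t within {0..})"
      unfolding has_real_derivative_iff_has_vector_derivative
      by (rule bounded_bilinear.has_vector_derivative[OF bounded_bilinear_inner f
        bounded_linear.has_vector_derivative[OF matrix_vector_mul_bounded_linear f]])
    moreover have "f' \<bullet> (Q *v f t) = f t \<bullet> (Q *v f')" using Q by (metis inner_commute)
    ultimately show ?thesis by simp
  qed
  have diag_sym: "x \<bullet> (diag_matrix f *v y) = (diag_matrix f *v x) \<bullet> y" for f and x y :: "real^'n"
    by (simp add: inner_diag_matrix inner_commute[of _ y] mult_ac)
  let ?w' = "\<chi> i. (u t $ i - d i * w t $ i + q t $ i) / m i"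
  let ?q' = "\<chi> i. (- r i * w t $ i - q t $ i) / \<tau> i"
  have der_w: "(w has_vector_derivative ?w') (at t within {0..})"
    and der_u: "(u has_vector_derivative - (L *v w t)) (at t within {0..})"
    and der_q: "(q has_vector_derivative ?q') (at t within {0..})"
    using T \<open>t \<ge> 0\<close> by (simp_all add: trajectory_def)
  have "((\<lambda>t. energy (w t, u t, q t)) has_real_derivative
     (2 * (u t \<bullet> (J *v - (L *v w t))) + 2 * (w t \<bullet> (diag_matrix m *v ?w')) +
      2 * (q t \<bullet> (diag_matrix (\<lambda>i. \<tau> i * k i) *v ?q'))) / 2) (at t within {0..})"
    unfolding energy_def prod.case
    by (intro DERIV_cdivide DERIV_add der der_w der_u der_q J_sym diag_sym)
  moreover have "(2 * (u t \<bullet> (J *v - (L *v w t))) + 2 * (w t \<bullet> (diag_matrix m *v ?w')) +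
      2 * (q t \<bullet> (diag_matrix (\<lambda>i. \<tau> i * k i) *v ?q'))) / 2 = - dissipation (w t, q t)"
  proof -
    have "w t \<bullet> (diag_matrix m *v ?w') = (\<Sum>i\<in>UNIV. w t $ i * (u t $ i - d i * w t $ i + q t $ i))"
      unfolding inner_diag_matrix using m_pos by (intro sum.cong) (auto simp: less_imp_neq[symmetric])
    moreover have "q t \<bullet> (diag_matrix (\<lambda>i. \<tau> i * k i) *v ?q') = (\<Sum>i\<in>UNIV. k i * q t $ i * (- r i * w t $ i - q t $ i))"
      unfolding inner_diag_matrix using \<tau>_pos by (intro sum.cong) (auto simp: less_imp_neq[symmetric])
    moreover have "u t \<bullet> (J *v - (L *v w t)) = - (\<Sum>i\<in>UNIV. u t $ i * w t $ i)"
      using J_L[OF u, of "w t"] by (simp add: inner_vec_def vec.neg sum_negf)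
    moreover have "(2 * a + 2 * b + 2 * c) / 2 = a + b + c" for a b c :: real by simp
    ultimately show ?thesis
      unfolding energy_identity[symmetric] by (simp only:) (simp add: algebra_simps sum.distrib sum_subtractf sum_negf)
  qed
  ultimately show ?thesis by simp
qed

lemma cross_derivative:
  assumes T: "trajectory w u q" and "t \<ge> 0"
  shows "((\<lambda>t. cross (w t, u t, q t)) has_real_derivative
    u t \<bullet> (u t - diag_matrix d *v w t + q t) - (L *v w t) \<bullet> (diag_matrix m *v w t)) (at t within {0..})"
proof -
  let ?w' = "\<chi> i. (u t $ i - d i * w t $ i + q t $ i) / m i"
  have der_w: "(w has_vector_derivative ?w') (at t within {0..})"
    and der_u: "(u has_vector_derivative - (L *v w t)) (at t within {0..})"
    using T \<open>t \<ge> 0\<close> by (simp_all add: trajectory_def)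
  have "diag_matrix m *v ?w' = u t - diag_matrix d *v w t + q t"
    using m_pos by (simp add: diag_matrix_vector_mult vec_eq_iff less_imp_neq[symmetric])
  moreover have "((\<lambda>t. cross (w t, u t, q t)) has_real_derivative
     u t \<bullet> (diag_matrix m *v ?w') + (- (L *v w t)) \<bullet> (diag_matrix m *v w t)) (at t within {0..})"
    unfolding cross_def prod.case has_real_derivative_iff_has_vector_derivative
    by (rule bounded_bilinear.has_vector_derivative[OF bounded_bilinear_inner der_u
        bounded_linear.has_vector_derivative[OF matrix_vector_mul_bounded_linear der_w]])
  ultimately show ?thesis by simp
qed

text \<open>The energy alone does not dissipate \<open>u\<close>; subtracting a small multiple of the cross term makes
  the Lyapunov function strict.\<close>

lemma trajectory_decay:
  obtains K l where "l > 0" "\<And>w u q t. trajectory w u q \<Longrightarrow> vec 1 \<bullet> u 0 = 0 \<Longrightarrow> t \<ge> 0 \<Longrightarrow>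
    norm (w t, u t, q t) \<le> K * exp (- l * t) * norm (w 0, u 0, q 0)"
proof -
  note cont = continuous_on_mult_left continuous_on_inner bounded_linear.continuous_on[OF matrix_vector_mul_bounded_linear]
  obtain c where c: "c > 0" "\<And>y. c * (norm y)\<^sup>2 \<le> energy y"
  proof (rule quadratic_form_lower_bound[of energy])
    show "continuous_on UNIV energy"
      unfolding energy_def case_prod_beta by (intro continuous_intros cont) auto
    show "energy (a *\<^sub>R y) = a\<^sup>2 * energy y" for a y
      by (simp add: energy_def case_prod_beta matrix_vector_mult_scaleR power2_eq_square algebra_simps)
  qed (use energy_pos in auto)
  obtain e where e: "e > 0" "\<And>y. e * (norm y)\<^sup>2 \<le> dissipation y"
  proof (rule quadratic_form_lower_bound[of dissipation])
    show "continuous_on UNIV dissipation"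
      unfolding dissipation_def case_prod_beta by (intro continuous_intros cont)
    show "dissipation (a *\<^sub>R y) = a\<^sup>2 * dissipation y" for a y
      by (simp add: dissipation_def case_prod_beta power2_eq_square sum_distrib_left algebra_simps)
  qed (use dissipation_pos in auto)
  \<comment> \<open>What remains of the negated cross derivative, apart from minus half of |u|^2,
    once the product of \<open>u\<close> with \<open>q - D w\<close> is split by Young's
    inequality.\<close>
  define g where "g = (\<lambda>(w :: real^'n, q :: real^'n). 1 / 2 * (norm (q - diag_matrix d *v w))\<^sup>2 + (L *v w) \<bullet> (diag_matrix m *v w))"
  obtain K1 where K1: "K1 > 0" "\<And>y. g y \<le> K1 * (norm y)\<^sup>2"
  proof (rule quadratic_form_upper_bound[of g])
    show "continuous_on UNIV g"
      unfolding g_def case_prod_beta by (intro continuous_intros cont)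
    show "g (a *\<^sub>R y) = a\<^sup>2 * g y" for a y
    proof -
      have "norm (a *\<^sub>R (snd y - diag_matrix d *v fst y)) = \<bar>a\<bar> * norm (snd y - diag_matrix d *v fst y)"
        by simp
      then show ?thesis
        by (simp add: g_def case_prod_beta matrix_vector_mult_scaleR power_mult_distrib power2_eq_square[of a]
            algebra_simps flip: scaleR_diff_right)
    qed
  qed auto
  have cross_scale: "cross (a *\<^sub>R y) = a\<^sup>2 * cross y" for a y
    by (simp add: cross_def case_prod_beta matrix_vector_mult_scaleR power2_eq_square algebra_simps)
  have cross_cont: "continuous_on UNIV cross"
    unfolding cross_def case_prod_beta by (intro continuous_intros cont)
  obtain K2 where K2: "K2 > 0" "\<And>y. cross y \<le> K2 * (norm y)\<^sup>2"
    using quadratic_form_upper_bound[OF cross_cont cross_scale] by blast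
  \<comment> \<open>The first bound keeps half of the coercivity of \<open>energy\<close>, the
    second half of the dissipation.\<close>
  define \<delta> where "\<delta> = min (c / (2 * K2)) (e / (2 * K1))"
  have \<delta>: "\<delta> > 0" "\<delta> * K2 \<le> c / 2" "\<delta> * K1 \<le> e / 2"
    using c e K1 K2 by (auto simp: \<delta>_def min_def field_simps)
  define W where "W y = energy y - \<delta> * cross y" for y
  obtain K3 where K3: "K3 > 0" "\<And>y. W y \<le> K3 * (norm y)\<^sup>2"
  proof (rule quadratic_form_upper_bound[of W])
    show "continuous_on UNIV W"
      unfolding W_def energy_def cross_def case_prod_beta by (intro continuous_intros cont) auto
    show "W (a *\<^sub>R y) = a\<^sup>2 * W y" for a y
      unfolding W_def cross_scale
      by (simp add: energy_def case_prod_beta matrix_vector_mult_scaleR power2_eq_square algebra_simps)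
  qed auto
  have W_lower: "c / 2 * (norm y)\<^sup>2 \<le> W y" for y
  proof -
    have "\<delta> * cross y \<le> \<delta> * (K2 * (norm y)\<^sup>2)" using K2(2) \<delta>(1) by (intro mult_left_mono) auto
    also have "\<dots> \<le> c / 2 * (norm y)\<^sup>2" using mult_right_mono[OF \<delta>(2), of "(norm y)\<^sup>2"] by (simp add: mult_ac)
    finally show ?thesis using c(2)[of y] by (simp add: W_def)
  qed
  \<comment> \<open>The smaller of the two dissipation coefficients that survive, one for
    \<open>(w, q)\<close> and one for \<open>u\<close>; dividing by \<open>K3\<close> converts a
    rate in the squared norm into a rate in \<open>W\<close>.\<close>
  define \<mu> where "\<mu> = min (e / 2) (\<delta> / 2)"
  have \<mu>: "\<mu> > 0" "\<mu> \<le> e / 2" "\<mu> \<le> \<delta> / 2" using e \<delta> by (auto simp: \<mu>_def)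
  define l where "l = \<mu> / K3"
  have "l > 0" using \<mu> K3 by (simp add: l_def)
  have norm3: "(norm (w, u, q))\<^sup>2 = (norm (w, q))\<^sup>2 + (norm u)\<^sup>2" for w u q :: "real^'n"
    by (simp add: norm_Pair)
  have decrease: "- dissipation (w, q) - \<delta> * (u \<bullet> (u - diag_matrix d *v w + q) - (L *v w) \<bullet> (diag_matrix m *v w))
      \<le> - l * W (w, u, q)" for w u q
  proof -
    \<comment> \<open>Young's inequality, from the nonnegative square of
      \<open>u + b\<close>.\<close>
    have "- (u \<bullet> b) \<le> (norm u)\<^sup>2 / 2 + (norm b)\<^sup>2 / 2" for b
      using inner_ge_zero[of "u + b"]
      by (simp add: power2_norm_eq_inner inner_add_left inner_add_right inner_commute[of b u])
    from this[of "q - diag_matrix d *v w"] have "- (u \<bullet> (u - diag_matrix d *v w + q) - (L *v w) \<bullet> (diag_matrix m *v w)) \<le> g (w, q) - (norm u)\<^sup>2 / 2"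
      by (simp add: g_def inner_diff_right inner_add_right power2_norm_eq_inner)
    also have "\<dots> \<le> K1 * (norm (w, q))\<^sup>2 - (norm u)\<^sup>2 / 2" using K1(2) by simp
    finally have "\<delta> * (- (u \<bullet> (u - diag_matrix d *v w + q) - (L *v w) \<bullet> (diag_matrix m *v w)))
      \<le> \<delta> * (K1 * (norm (w, q))\<^sup>2 - (norm u)\<^sup>2 / 2)" using \<delta>(1) by (intro mult_left_mono) auto
    then have "- dissipation (w, q) - \<delta> * (u \<bullet> (u - diag_matrix d *v w + q) - (L *v w) \<bullet> (diag_matrix m *v w))
      \<le> - (e * (norm (w, q))\<^sup>2) + (\<delta> * K1) * (norm (w, q))\<^sup>2 - \<delta> / 2 * (norm u)\<^sup>2"
      using e(2)[of "(w, q)"] by (simp add: algebra_simps)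
    also have "\<dots> \<le> - (e * (norm (w, q))\<^sup>2) + e / 2 * (norm (w, q))\<^sup>2 - \<delta> / 2 * (norm u)\<^sup>2"
      using mult_right_mono[OF \<delta>(3), of "(norm (w, q))\<^sup>2"] by simp
    also have "\<dots> = - (e / 2 * (norm (w, q))\<^sup>2) - \<delta> / 2 * (norm u)\<^sup>2" by simp
    also have "\<dots> \<le> - (\<mu> * (norm (w, u, q))\<^sup>2)"
      using mult_right_mono[OF \<mu>(2), of "(norm (w, q))\<^sup>2"] mult_right_mono[OF \<mu>(3), of "(norm u)\<^sup>2"]
      unfolding norm3 by (simp add: algebra_simps)
    also have "\<dots> \<le> - l * W (w, u, q)"
      using K3 \<mu>(1) by (simp add: l_def field_simps)
    finally show ?thesis .
  qed
  \<comment> \<open>The constant is the square root of the ratio of the upper bound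
    \<open>K3\<close> of \<open>W\<close> to its lower bound \<open>c / 2\<close>; the square root
    also halves the rate.\<close>
  have "norm (w t, u t, q t) \<le> sqrt (2 * K3 / c) * exp (- (l / 2) * t) * norm (w 0, u 0, q 0)"
    if T: "trajectory w u q" and u0: "vec 1 \<bullet> u 0 = 0" and "t \<ge> 0" for w u q t
  proof -
    define y where "y t = (w t, u t, q t)" for t
    have "W (y t) \<le> exp (- l * t) * W (y 0)"
    proof (rule real_derivative_le_exp[OF _ _ \<open>t \<ge> 0\<close>])
      fix s :: real assume s: "s \<ge> 0"
      have "vec 1 \<bullet> u s = 0" using trajectory_conserved[OF T s] u0 by simp
      then show "((\<lambda>s. W (y s)) has_real_derivative (- dissipation (w s, q s) -
          \<delta> * (u s \<bullet> (u s - diag_matrix d *v w s + q s) - (L *v w s) \<bullet> (diag_matrix m *v w s)))) (at s within {0..})"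
        unfolding W_def y_def
        by (intro DERIV_diff DERIV_cmult energy_derivative[OF T s] cross_derivative[OF T s])
    qed (use decrease in \<open>simp add: y_def\<close>)
    then have "c / 2 * (norm (y t))\<^sup>2 \<le> exp (- l * t) * (K3 * (norm (y 0))\<^sup>2)"
      using W_lower[of "y t"] mult_left_mono[OF K3(2)[of "y 0"], of "exp (- l * t)"] exp_ge_zero[of "- l * t"] by linarith
    then have "(norm (y t))\<^sup>2 \<le> 2 * K3 / c * exp (- l * t) * (norm (y 0))\<^sup>2"
      using c(1) by (simp add: field_simps)
    also have "\<dots> = (sqrt (2 * K3 / c) * exp (- (l / 2) * t) * norm (y 0))\<^sup>2"
    proof -
      have e: "(exp (- (l / 2) * t))\<^sup>2 = exp (- l * t)" by (simp add: power2_eq_square flip: exp_add)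
      have "0 \<le> 2 * K3 / c" using c(1) K3(1) by simp
      then show ?thesis by (simp only: power_mult_distrib e real_sqrt_pow2)
    qed
    finally have "norm (y t) \<le> sqrt (2 * K3 / c) * exp (- (l / 2) * t) * norm (y 0)"
      by (rule power2_le_imp_le) (use c(1) K3(1) in simp)
    then show ?thesis by (simp only: y_def)
  qed
  with \<open>l > 0\<close> show ?thesis by (intro that[of "l / 2"]) (assumption | simp)+
qed

end

section \<open>Block coordinates\<close>

lemma stack3_nth [simp]:
  "stack3 a b c $ Inl i = a $ i" "stack3 a b c $ Inr (Inl i) = b $ i" "stack3 a b c $ Inr (Inr i) = c $ i"
  by (simp_all add: stack3_def)

definition block1 :: "'a^('n + 'n + 'n) \<Rightarrow> 'a^'n" where "block1 x = (\<chi> i. x $ Inl i)"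
definition block2 :: "'a^('n + 'n + 'n) \<Rightarrow> 'a^'n" where "block2 x = (\<chi> i. x $ Inr (Inl i))"
definition block3 :: "'a^('n + 'n + 'n) \<Rightarrow> 'a^'n" where "block3 x = (\<chi> i. x $ Inr (Inr i))"

lemma block_stack3 [simp]:
  "block1 (stack3 a b c) = a" "block2 (stack3 a b c) = b" "block3 (stack3 a b c) = c"
  by (simp_all add: block1_def block2_def block3_def vec_eq_iff)

lemma vec3_eq_iff:
  "x = y \<longleftrightarrow> (\<forall>i. x $ Inl i = y $ Inl i) \<and> (\<forall>i. x $ Inr (Inl i) = y $ Inr (Inl i)) \<and>
    (\<forall>i. x $ Inr (Inr i) = y $ Inr (Inr i))"
  for x y :: "'a^('n::finite + 'n + 'n)"
  unfolding vec_eq_iff by (metis sum.exhaust)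

lemma stack3_blocks [simp]: "stack3 (block1 x) (block2 x) (block3 x) = x"
  by (simp add: vec3_eq_iff block1_def block2_def block3_def)

lemma sum_UNIV_3:
  "(\<Sum>k\<in>(UNIV :: ('n::finite + 'n + 'n) set). f k) =
    (\<Sum>i\<in>UNIV. f (Inl i)) + ((\<Sum>i\<in>UNIV. f (Inr (Inl i))) + (\<Sum>i\<in>UNIV. f (Inr (Inr i))))"
  by (simp add: UNIV_Plus_UNIV[symmetric] sum.Plus del: UNIV_Plus_UNIV)

lemma stack3_mult: "stack3 P Q S *v x = stack3 (P *v x) (Q *v x) (S *v x)"
  by (simp add: vec3_eq_iff matrix_vector_mult_def)

lemma beside3_mult: "beside3 P Q S *v x = P *v block1 x + Q *v block2 x + S *v block3 x"
  by (simp add: vec_eq_iff matrix_vector_mult_def beside3_def sum_UNIV_3 block1_def block2_def block3_def add.assoc)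

lemma inner_stack3: "stack3 a b c \<bullet> x = a \<bullet> block1 x + b \<bullet> block2 x + c \<bullet> block3 x"
  by (simp add: inner_vec_def sum_UNIV_3 block1_def block2_def block3_def)

lemma bounded_linear_blocks:
  "bounded_linear (block1 :: real^('n + 'n + 'n) \<Rightarrow> real^'n::finite)"
  "bounded_linear (block2 :: real^('n + 'n + 'n) \<Rightarrow> real^'n::finite)"
  "bounded_linear (block3 :: real^('n + 'n + 'n) \<Rightarrow> real^'n::finite)"
  by (auto intro!: linearI simp: linear_conv_bounded_linear[symmetric] block1_def block2_def block3_def vec_eq_iff)

lemma matrix_inv_unique:
  assumes "A ** B = mat 1" "B ** A = mat 1"
  shows "matrix_inv A = (B :: real^'n^'n)"
proof -
  have "A ** matrix_inv A = mat 1 \<and> matrix_inv A ** A = mat 1"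
    unfolding matrix_inv_def by (rule someI[of _ B]) (use assms in simp)
  then show ?thesis by (metis assms(2) matrix_mul_assoc matrix_mul_lid matrix_mul_rid)
qed

lemma diag_matrix_mult: "diag_matrix f ** diag_matrix g = diag_matrix (\<lambda>i. f i * g i)"
  by (simp add: matrix_eq diag_matrix_vector_mult mult.assoc flip: matrix_vector_mul_assoc)

lemma matrix_inv_diag_matrix: "(\<And>i. f i \<noteq> 0) \<Longrightarrow> matrix_inv (diag_matrix f) = diag_matrix (\<lambda>i. 1 / f i)"
  by (rule matrix_inv_unique) (simp_all add: diag_matrix_mult, simp_all add: diag_matrix_def mat_def)

section \<open>The state space: equilibria, their dual functional, and the coordinates (\<omega>, u,
  q)\<close>

context swing_network
begin

definition imbalance :: "real^('n + 'n + 'n) \<Rightarrow> real^'n" where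
  "imbalance x = (\<chi> i. d i * block1 x $ i + m i * block2 x $ i - block3 x $ i)"

text \<open>The action of \<open>A\<close> in coordinates, so that matrix inverses have to be
  resolved only once, in \<open>A_matrix_mult\<close>.\<close>

definition step_map :: "real^('n + 'n + 'n) \<Rightarrow> real^('n + 'n + 'n)" where
  "step_map x = stack3 (block2 x)
     (\<chi> i. (- d i * block2 x $ i - r i / \<tau> i * block1 x $ i - block3 x $ i / \<tau> i - (L *v block1 x) $ i) / m i)
     (\<chi> i. (- r i * block1 x $ i - block3 x $ i) / \<tau> i)"

text \<open>The left null vector of \<open>A\<close>, normalized against \<open>v\<close>;
  \<open>w \<bullet> x\<close> is the common frequency to which the state \<open>x\<close>
  settles.\<close>

definition w :: "real^('n + 'n + 'n)" where
  "w = (1 / (\<Sum>i\<in>UNIV. d i)) *\<^sub>R stack3 (\<chi> i. d i) (\<chi> i. m i) (- vec 1)"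

definition v :: "real^('n + 'n + 'n)" where
  "v = stack3 (vec 1) 0 (\<chi> i. - r i)"

text \<open>The imbalance in the steady state with frequency deviation 1 at every bus.\<close>

definition equilibrium :: "real^'n" where
  "equilibrium = (\<chi> i. d i + r i)"

text \<open>Solves the bus equation for the frequency derivative, thus inverting the passage to the
  coordinates (\<omega>, u, q).\<close>

definition unbalance :: "(real^'n) \<times> (real^'n) \<times> (real^'n) \<Rightarrow> real^('n + 'n + 'n)" where
  "unbalance = (\<lambda>(a, u, q). stack3 a (\<chi> i. (u $ i - d i * a $ i + q $ i) / m i) q)"

lemma sum_d_pos: "(\<Sum>i\<in>UNIV. d i) > 0"
  by (rule sum_pos) (use d_pos in auto)

lemma m_nonzero [simp]: "m i \<noteq> 0" and \<tau>_nonzero [simp]: "\<tau> i \<noteq> 0"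
  using m_pos[of i] \<tau>_pos[of i] by simp_all

lemma bounded_linear_imbalance: "bounded_linear imbalance"
  by (auto intro!: linearI simp: linear_conv_bounded_linear[symmetric] imbalance_def block1_def block2_def block3_def
      vec_eq_iff algebra_simps)

lemma bounded_linear_unbalance: "bounded_linear unbalance"
  by (auto intro!: linearI simp: linear_conv_bounded_linear[symmetric] unbalance_def vec3_eq_iff field_simps)

lemma unbalance_imbalance: "unbalance (block1 x, imbalance x, block3 x) = x"
proof -
  have "(\<chi> i. (imbalance x $ i - d i * block1 x $ i + block3 x $ i) / m i) = block2 x"
    by (simp add: imbalance_def vec_eq_iff)
  then show ?thesis by (simp add: unbalance_def)
qed

lemma w_inner: "w \<bullet> x = (vec 1 \<bullet> imbalance x) / (\<Sum>i\<in>UNIV. d i)"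
  by (simp add: w_def inner_stack3)
     (simp add: inner_vec_def imbalance_def sum.distrib sum_subtractf sum_negf)

lemma step_map_v: "step_map v = 0"
  using L_one by (simp add: step_map_def v_def vec3_eq_iff)

lemma imbalance_v: "imbalance v = equilibrium"
  by (simp add: imbalance_def v_def equilibrium_def vec_eq_iff)

lemma w_v: "w \<bullet> v = 1"
  using sum_d_pos sum_r by (simp add: w_inner imbalance_v) (simp add: equilibrium_def inner_vec_def sum.distrib)

text \<open>The damping terms cancel, and so do the internal terms against the derivative of the
  third block, leaving the line flows.\<close>

lemma imbalance_step_map: "imbalance (step_map x) = - (L *v block1 x)"
  by (simp add: imbalance_def step_map_def vec_eq_iff) (simp add: diff_divide_distrib)

lemma trajectory_state:
  assumes x: "\<And>t. t \<ge> 0 \<Longrightarrow> (x has_vector_derivative step_map (x t)) (at t within {0..})"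
  shows "trajectory (\<lambda>t. block1 (x t)) (\<lambda>t. imbalance (x t)) (\<lambda>t. block3 (x t))"
proof -
  have "block1 (step_map (x t)) = (\<chi> i. (imbalance (x t) $ i - d i * block1 (x t) $ i + block3 (x t) $ i) / m i)" for t
    by (simp add: step_map_def imbalance_def vec_eq_iff)
  moreover have "block3 (step_map (x t)) = (\<chi> i. (- r i * block1 (x t) $ i - block3 (x t) $ i) / \<tau> i)" for t
    by (simp add: step_map_def)
  ultimately show ?thesis
    using bounded_linear.has_vector_derivative[OF bounded_linear_blocks(1) x]
      bounded_linear.has_vector_derivative[OF bounded_linear_imbalance x]
      bounded_linear.has_vector_derivative[OF bounded_linear_blocks(3) x]
    by (simp add: trajectory_def imbalance_step_map)
qed

lemma semistable:
  assumes A: "\<And>x. A *v x = step_map x"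
  obtains K l where "l > 0" "\<And>t x. t \<ge> 0 \<Longrightarrow>
    norm (matrix_exp (t *\<^sub>R A) *v x - (w \<bullet> x) *\<^sub>R v) \<le> K * exp (- l * t) * norm x"
proof -
  obtain K l where l: "l > 0" and K: "\<And>w u q t. trajectory w u q \<Longrightarrow> vec 1 \<bullet> u 0 = 0 \<Longrightarrow> t \<ge> 0 \<Longrightarrow>
      norm (w t, u t, q t) \<le> K * exp (- l * t) * norm (w 0, u 0, q 0)"
    using trajectory_decay by metis
  let ?P = "\<lambda>x. (block1 x, imbalance x, block3 x)"
  have bl: "bounded_linear ?P"
    by (intro bounded_linear_Pair bounded_linear_blocks bounded_linear_imbalance)
  obtain K1 where K1: "K1 > 0" "\<And>y. norm (unbalance y) \<le> norm y * K1"
    using bounded_linear.pos_bounded[OF bounded_linear_unbalance] by blast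
  have "bounded_linear (\<lambda>x. ?P (x - (w \<bullet> x) *\<^sub>R v))"
    by (intro bounded_linear_compose[OF bl] bounded_linear_sub bounded_linear_ident
        bounded_linear_scaleR_const bounded_linear_inner_right)
  then obtain K2 where K2: "K2 > 0" "\<And>x. norm (?P (x - (w \<bullet> x) *\<^sub>R v)) \<le> norm x * K2"
    using bounded_linear.pos_bounded by blast
  have Ev: "matrix_exp (t *\<^sub>R A) *v v = v" if "t \<ge> 0" for t
    using linear_ode_unique[of "\<lambda>_. v" A t] that by (simp add: A step_map_v)
  \<comment> \<open>\<open>K1\<close> bounds the return from the coordinates, \<open>K2\<close> the
    projection followed by the passage to them. The sign of \<open>K\<close> is unknown, hence the
    absolute value.\<close>
  have "norm (matrix_exp (t *\<^sub>R A) *v x - (w \<bullet> x) *\<^sub>R v) \<le> \<bar>K\<bar> * K1 * K2 * exp (- l * t) * norm x" if "t \<ge> 0" for t x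
  proof -
    \<comment> \<open>Removing the component along \<open>v\<close> makes the sum of the imbalance
      0, the condition under which trajectories decay.\<close>
    let ?z = "x - (w \<bullet> x) *\<^sub>R v"
    let ?y = "\<lambda>t. matrix_exp (t *\<^sub>R A) *v ?z"
    have "trajectory (\<lambda>t. block1 (?y t)) (\<lambda>t. imbalance (?y t)) (\<lambda>t. block3 (?y t))"
      using has_vector_derivative_matrix_exp_mult[of A ?z] by (intro trajectory_state) (simp add: A)
    moreover have "w \<bullet> ?z = 0" by (simp add: inner_diff_right w_v)
    then have "vec 1 \<bullet> imbalance (?y 0) = 0" using sum_d_pos by (simp add: w_inner)
    ultimately have "norm (?P (?y t)) \<le> K * exp (- l * t) * norm (?P (?y 0))"
      using K \<open>t \<ge> 0\<close> by blast
    also have "\<dots> \<le> \<bar>K\<bar> * exp (- l * t) * (norm x * K2)"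
      using K2(2)[of x] by (intro mult_mono) auto
    finally have "norm (?P (?y t)) * K1 \<le> \<bar>K\<bar> * exp (- l * t) * (norm x * K2) * K1"
      using K1(1) by (intro mult_right_mono) auto
    moreover have "norm (?y t) \<le> norm (?P (?y t)) * K1"
      using K1(2)[of "?P (?y t)"] by (simp only: unbalance_imbalance)
    ultimately have "norm (?y t) \<le> \<bar>K\<bar> * exp (- l * t) * (norm x * K2) * K1" by linarith
    moreover have "?y t = matrix_exp (t *\<^sub>R A) *v x - (w \<bullet> x) *\<^sub>R v"
      using Ev[OF that] by (simp add: matrix_vector_mult_diff_distrib matrix_vector_mult_scaleR)
    ultimately show ?thesis by (simp add: mult_ac)
  qed
  then show ?thesis using that l by blast
qed

end

section \<open>The network under frequency shaping control\<close>

lemma LB_matrix_nth: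
  "LB_matrix N $ i $ j = (\<Sum>l\<in>UNIV. line_weight N i l * ((if i = j then 1 else 0) - (if l = j then 1 else 0)))"
proof -
  have "((\<lambda>x. line_flow_sum N i ((eq_angle N)(j := x))) has_field_derivative
      (\<Sum>l\<in>UNIV. volt_mag N i * volt_mag N l * suscept N i l * (cos (eq_angle N i - eq_angle N l) *
         ((if i = j then 1 else 0) - (if l = j then 1 else 0))))) (at (eq_angle N j))"
    unfolding line_flow_sum_def
  proof (intro DERIV_sum DERIV_cmult)
    fix l
    \<comment> \<open>Only the angle of bus j varies, so the inner derivatives are Kronecker
      deltas.\<close>
    have *: "((\<lambda>x. ((eq_angle N)(j := x)) i) has_field_derivative (if i = j then 1 else 0)) (at (eq_angle N j))" for i
      by (auto intro!: derivative_eq_intros)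
    show "((\<lambda>x. sin (((eq_angle N)(j := x)) i - ((eq_angle N)(j := x)) l)) has_field_derivative
        cos (eq_angle N i - eq_angle N l) * ((if i = j then 1 else 0) - (if l = j then 1 else 0))) (at (eq_angle N j))"
      using DERIV_chain2[OF DERIV_sin DERIV_diff[OF *[of i] *[of l]]] by (simp only: fun_upd_triv)
  qed
  then show ?thesis
    by (simp add: LB_matrix_def DERIV_imp_deriv line_weight_def sum_distrib_left mult_ac)
qed

lemma LB_matrix_mult: "(LB_matrix N *v x) $ i = (\<Sum>l\<in>UNIV. line_weight N i l * (x $ i - x $ l))"
proof -
  have "(LB_matrix N *v x) $ i =
      (\<Sum>j\<in>UNIV. \<Sum>l\<in>UNIV. line_weight N i l * ((if i = j then 1 else 0) - (if l = j then 1 else 0)) * x $ j)"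
    by (simp add: matrix_vector_mult_def LB_matrix_nth sum_distrib_right)
  also have "\<dots> = (\<Sum>l\<in>UNIV. \<Sum>j\<in>UNIV. line_weight N i l * ((if i = j then 1 else 0) - (if l = j then 1 else 0)) * x $ j)"
    by (rule sum.swap)
  also have "\<dots> = (\<Sum>l\<in>UNIV. line_weight N i l * (x $ i - x $ l))"
  proof (rule sum.cong[OF refl])
    fix l
    have "(\<Sum>j\<in>UNIV. line_weight N i l * ((if i = j then 1 else 0) - (if l = j then 1 else 0)) * x $ j) =
        (\<Sum>j\<in>UNIV. (if i = j then line_weight N i l * x $ j else 0) - (if l = j then line_weight N i l * x $ j else 0))"
      by (intro sum.cong) auto
    then show "(\<Sum>j\<in>UNIV. line_weight N i l * ((if i = j then 1 else 0) - (if l = j then 1 else 0)) * x $ j) =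
        line_weight N i l * (x $ i - x $ l)"
      by (simp add: sum_subtractf algebra_simps)
  qed
  finally show ?thesis .
qed

text \<open>Averaging the double sum with its transpose gives a form from which symmetry,
  nonnegativity and the kernel can be read off.\<close>

lemma inner_LB_matrix:
  assumes sym: "\<And>i j. line_weight N i j = line_weight N j i"
  shows "x \<bullet> (LB_matrix N *v y) = (\<Sum>i\<in>UNIV. \<Sum>l\<in>UNIV. line_weight N i l * (x $ i - x $ l) * (y $ i - y $ l)) / 2"
proof -
  have e: "x \<bullet> (LB_matrix N *v y) = (\<Sum>i\<in>UNIV. \<Sum>l\<in>UNIV. line_weight N i l * x $ i * (y $ i - y $ l))"
    by (simp add: inner_vec_def LB_matrix_mult sum_distrib_left mult_ac)
  also have "\<dots> = (\<Sum>i\<in>UNIV. \<Sum>l\<in>UNIV. line_weight N l i * x $ l * (y $ l - y $ i))"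
    by (rule sum.swap)
  finally have "2 * (x \<bullet> (LB_matrix N *v y)) = (\<Sum>i\<in>UNIV. \<Sum>l\<in>UNIV. line_weight N i l * x $ i * (y $ i - y $ l)) +
     (\<Sum>i\<in>UNIV. \<Sum>l\<in>UNIV. line_weight N l i * x $ l * (y $ l - y $ i))"
    using e by simp
  also have "\<dots> = (\<Sum>i\<in>UNIV. \<Sum>l\<in>UNIV. line_weight N i l * (x $ i - x $ l) * (y $ i - y $ l))"
    unfolding sum.distrib[symmetric]
    by (intro sum.cong refl) (simp add: sym[of l i for l i] algebra_simps)
  finally show ?thesis by simp
qed

section \<open>The controlled network as an instance of the swing dynamics\<close>

locale shaped_network =
  fixes N :: "('n::finite) network"
  assumes transmission: "transmission_network N" and buses: "bus_parameters N" and shaping: "frequency_shaping N"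
begin

definition time_const :: "'n \<Rightarrow> real" where "time_const i = (if i \<in> gens N then turb_time N i else ctrl_time N i)"

definition droop_coeff :: "'n \<Rightarrow> real" where "droop_coeff i = (if i \<in> gens N then turb_droop N i else - ctrl_gain N i)"

lemma weight_sym: "line_weight N i j = line_weight N j i"
proof -
  have "suscept N i j = suscept N j i" using transmission by (auto simp: transmission_network_def)
  moreover have "cos (eq_angle N i - eq_angle N j) = cos (eq_angle N j - eq_angle N i)"
    by (metis cos_minus minus_diff_eq)
  ultimately show ?thesis by (simp add: line_weight_def)
qed

text \<open>A diagonal weight contains the self-susceptance, whose sign is free; in the Laplacian
  form it multiplies a zero difference.\<close>

lemma weight_nonneg: "i \<noteq> j \<Longrightarrow> line_weight N i j \<ge> 0"
  using transmission
  by (cases "{i, j} \<in> lines N") (auto simp: transmission_network_def less_imp_le line_weight_def)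

text \<open>A vanishing sum of nonnegative terms forces equal values across every line, and
  connectedness spreads this equality from a reference bus to all buses.\<close>

lemma LB_kernel: "x \<bullet> (LB_matrix N *v x) \<ge> 0"
  "x \<bullet> (LB_matrix N *v x) = 0 \<Longrightarrow> \<exists>c. x = c *\<^sub>R vec 1"
proof -
  have nn: "line_weight N i l * (x $ i - x $ l) * (x $ i - x $ l) \<ge> 0" for i l
    using weight_nonneg[of i l] by (cases "i = l") (auto simp: mult.assoc)
  then show "x \<bullet> (LB_matrix N *v x) \<ge> 0"
    unfolding inner_LB_matrix[OF weight_sym] by (simp add: sum_nonneg)
  assume "x \<bullet> (LB_matrix N *v x) = 0"
  then have z: "line_weight N i l * (x $ i - x $ l) * (x $ i - x $ l) = 0" for i l
    unfolding inner_LB_matrix[OF weight_sym] using nn by (simp add: sum_nonneg_eq_0_iff sum_nonneg)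
  have eq: "x $ i = x $ l" if "{i, l} \<in> lines N" for i l
  proof -
    have "line_weight N i l > 0" using transmission that unfolding transmission_network_def by blast
    then show ?thesis using z[of i l] by simp
  qed
  fix i0 :: 'n
  have "x $ j = x $ i0" for j
  proof -
    have "(i0, j) \<in> {(a, b). {a, b} \<in> lines N}\<^sup>*" using transmission by (auto simp: transmission_network_def)
    then show ?thesis by (induction rule: rtrancl_induct) (auto dest: eq)
  qed
  then show "\<exists>c. x = c *\<^sub>R vec 1" by (intro exI[of _ "x $ i0"]) (simp add: vec_eq_iff)
qed

lemma gen_params: "i \<in> gens N \<Longrightarrow> inertia N i > 0 \<and> damping N i > 0 \<and> turb_time N i > 0 \<and> turb_droop N i > 0"
  and inv_params: "i \<notin> gens N \<Longrightarrow>
    inertia N i > 0 \<and> damping N i > ctrl_gain N i \<and> ctrl_gain N i \<ge> 0 \<and> ctrl_time N i > 0"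
  using buses by (auto simp: bus_parameters_def invs_def)

text \<open>The tuning identity at \<open>s = 0\<close>.\<close>

lemma sum_droop_coeff: "(\<Sum>i\<in>UNIV. droop_coeff i) = 0"
proof -
  have "of_real (\<Sum>i\<in>invs N. ctrl_gain N i) = (of_real (\<Sum>i\<in>gens N. turb_droop N i) :: complex)"
    using shaping[unfolded frequency_shaping_def, rule_format, of 0] by simp
  then have "(\<Sum>i\<in>invs N. ctrl_gain N i) = (\<Sum>i\<in>gens N. turb_droop N i)"
    by (simp only: of_real_eq_iff)
  moreover have "(\<Sum>i\<in>UNIV. droop_coeff i) = (\<Sum>i\<in>gens N. turb_droop N i) + (\<Sum>i\<in>invs N. - ctrl_gain N i)"
    unfolding droop_coeff_def invs_def by (simp add: sum.If_cases)
  ultimately show ?thesis by (simp add: sum_negf)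
qed

sublocale swing_network "inertia N" "damping N" time_const droop_coeff "LB_matrix N"
proof
  show "inertia N i > 0" "damping N i > 0" "time_const i > 0" "damping N i + droop_coeff i > 0" for i
    using gen_params[of i] inv_params[of i] by (cases "i \<in> gens N"; force simp: time_const_def droop_coeff_def)+
  show "x \<bullet> (LB_matrix N *v y) = (LB_matrix N *v x) \<bullet> y" for x y
    unfolding inner_commute[of "LB_matrix N *v x"] inner_LB_matrix[OF weight_sym] by (simp add: mult_ac)
  show "LB_matrix N *v vec 1 = 0" by (simp add: vec_eq_iff LB_matrix_mult)
qed (use LB_kernel sum_droop_coeff in auto)

lemma A_matrix_mult: "A_matrix N *v x = step_map x"
proof -
  have "M_matrix N ** T_matrix N = diag_matrix (\<lambda>i. inertia N i * time_const i)"
    by (simp add: M_matrix_def T_matrix_def diag_matrix_mult time_const_def)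
  moreover have "matrix_inv (T_matrix N) ** R_matrix N = diag_matrix (\<lambda>i. droop_coeff i / time_const i)"
  proof -
    have "T_matrix N = diag_matrix time_const" "R_matrix N = diag_matrix droop_coeff"
      by (simp_all add: T_matrix_def R_matrix_def time_const_def droop_coeff_def fun_eq_iff arg_cong[of _ _ diag_matrix])
    then show ?thesis by (simp add: matrix_inv_diag_matrix diag_matrix_mult)
  qed
  moreover have "T_matrix N = diag_matrix time_const"
    by (simp add: T_matrix_def time_const_def fun_eq_iff arg_cong[of _ _ diag_matrix])
  ultimately show ?thesis
    by (simp add: A_matrix_def Let_def stack3_mult beside3_mult step_map_def vec3_eq_iff matrix_vector_mult_uminus
        matrix_inv_diag_matrix M_matrix_def D_matrix_def diag_matrix_vector_mult diag_matrix_mult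
        matrix_vector_mult_add_rdistrib field_simps flip: matrix_vector_mul_assoc)
qed

lemma B_matrix_mult: "B_matrix N *v u = stack3 0 (\<chi> i. u $ i / inertia N i) 0"
  by (simp add: B_matrix_def stack3_mult M_matrix_def matrix_inv_diag_matrix diag_matrix_vector_mult)

text \<open>An impulse makes the imbalance jump by exactly its direction, so the network power
  starts from 0.\<close>

lemma imbalance_B: "imbalance (B_matrix N *v u) = u"
  by (simp add: imbalance_def B_matrix_mult vec_eq_iff)

text \<open>\<open>C\<close> removes from the imbalance its steady-state part, which is why it
  annihilates \<open>v\<close> and outputs the deviation from the limit.\<close>

lemma C_matrix_mult: "C_matrix N *v x = imbalance x - (w \<bullet> x) *\<^sub>R equilibrium"
proof -
  have R: "R_matrix N = diag_matrix droop_coeff"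
    by (simp add: R_matrix_def droop_coeff_def fun_eq_iff arg_cong[of _ _ diag_matrix])
  have I: "beside3 (D_matrix N) (M_matrix N) (- mat 1) *v x = imbalance x"
    by (simp add: beside3_mult D_matrix_def M_matrix_def diag_matrix_vector_mult imbalance_def vec_eq_iff
        matrix_vector_mult_uminus)
  have S: "vec 1 \<bullet> (D_matrix N *v vec 1) = (\<Sum>i\<in>UNIV. damping N i)"
    by (simp add: D_matrix_def inner_diag_matrix)
  have E: "(D_matrix N + R_matrix N) *v vec 1 = equilibrium"
    by (simp add: R D_matrix_def matrix_vector_mult_add_rdistrib diag_matrix_vector_mult equilibrium_def vec_eq_iff)
  have O: "(columnvector a ** (rowvector b :: real^'n^1)) *v y = (b \<bullet> y) *\<^sub>R a" for a b y :: "real^'n"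
    by (simp add: vec_eq_iff matrix_vector_mult_def matrix_matrix_mult_def columnvector_def rowvector_def inner_vec_def
        sum_distrib_left mult_ac)
  show ?thesis
    unfolding C_matrix_def Let_def matrix_vector_mul_assoc[symmetric] I matrix_vector_mult_diff_rdistrib S E
    by (simp add: O w_inner flip: scaleR_matrix_vector_assoc)
qed

lemma v_vector_eq: "v_vector N = v"
  by (simp add: v_vector_def v_def R_matrix_def diag_matrix_vector_mult droop_coeff_def vec3_eq_iff)

lemma system_semistable:
  obtains K l where "semistable_system (A_matrix N) (C_matrix N) v w K l"
proof -
  obtain K l where "l > 0" "\<And>t x. t \<ge> 0 \<Longrightarrow>
      norm (matrix_exp (t *\<^sub>R A_matrix N) *v x - (w \<bullet> x) *\<^sub>R v) \<le> K * exp (- l * t) * norm x"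
    using semistable[OF A_matrix_mult] by metis
  then have "semistable_system (A_matrix N) (C_matrix N) v w K l"
    by unfold_locales (auto simp: A_matrix_mult step_map_v C_matrix_mult imbalance_v w_v)
  then show ?thesis using that by blast
qed

section \<open>Step responses of the network and their transient effort\<close>

lemma step_response_state:
  assumes "network_step_response N u0 f f' q p_e"
  shows "state_response (A_matrix N) (B_matrix N) (step_signal u0) (\<lambda>t. stack3 (f t) (f' t) (q t))"
    and "t \<ge> 0 \<Longrightarrow> imbalance (stack3 (f t) (f' t) (q t)) = step_signal u0 t - p_e t"
proof -
  let ?x = "\<lambda>t. stack3 (f t) (f' t) (q t)"
  have neg: "f t = 0 \<and> f' t = 0 \<and> q t = 0" if "t < 0" for t
    using assms that unfolding network_step_response_def by blast
  have init: "f 0 = 0" "q 0 = 0"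
    using assms unfolding network_step_response_def by blast+
  have df: "(f has_vector_derivative f' t) (at t within {0..})"
    and bus: "inertia N i * f' t $ i = - damping N i * f t $ i + q t $ i + (u0 - p_e t) $ i"
    and dgen: "i \<in> gens N \<Longrightarrow> \<exists>q'. ((\<lambda>s. q s $ i) has_real_derivative q') (at t within {0..}) \<and>
             turb_time N i * q' = - turb_droop N i * f t $ i - q t $ i"
    and dinv: "i \<in> invs N \<Longrightarrow> \<exists>q'. ((\<lambda>s. q s $ i) has_real_derivative q') (at t within {0..}) \<and>
             ctrl_time N i * q' = ctrl_gain N i * f t $ i - q t $ i"
    and pe: "((\<lambda>s. LB_matrix N *v f s) has_integral p_e t - 0) {0..t}" if "t \<ge> 0" for t i
    using assms that by (auto simp: network_step_response_def step_signal_def)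
  have dq: "(q has_vector_derivative (\<chi> i. (- droop_coeff i * f t $ i - q t $ i) / time_const i)) (at t within {0..})" if t: "t \<ge> 0" for t
    unfolding has_vector_derivative_vec_iff
  proof
    fix i
    obtain q' where q': "((\<lambda>s. q s $ i) has_real_derivative q') (at t within {0..})"
      and "time_const i * q' = - droop_coeff i * f t $ i - q t $ i"
      using dgen[OF t, of i] dinv[OF t, of i] by (cases "i \<in> gens N") (auto simp: invs_def time_const_def droop_coeff_def)
    then have "q' = (- droop_coeff i * f t $ i - q t $ i) / time_const i" by (simp add: field_simps)
    with q' show "((\<lambda>t. q t $ i) has_vector_derivative (\<chi> i. (- droop_coeff i * f t $ i - q t $ i) / time_const i) $ i) (at t within {0..})"
      by (simp add: has_real_derivative_iff_has_vector_derivative)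
  qed
  have "continuous_on {0..} f"
    using df has_vector_derivative_continuous by (fastforce simp: continuous_on_eq_continuous_within)
  then have dpe: "(p_e has_vector_derivative LB_matrix N *v f t) (at t within {0..})" if "t \<ge> 0" for t
    by (intro has_vector_derivative_indefinite_integral[OF pe _ that]
        bounded_linear.continuous_on[OF matrix_vector_mul_bounded_linear])
  \<comment> \<open>The derivative of the frequency is not assumed differentiable; it is so because
    the bus equation expresses it through the differentiable signals \<open>f\<close>,
    \<open>q\<close> and \<open>p_e\<close>.\<close>
  have f': "f' t $ i = (- damping N i * f t $ i + q t $ i + (u0 $ i - p_e t $ i)) / inertia N i" if "t \<ge> 0" for t i
    using bus[OF that, of i] by (simp add: field_simps)
  have comp: "((\<lambda>t. g t $ i) has_real_derivative g' $ i) F" if "(g has_vector_derivative g') F" for g g' F i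
    using bounded_linear.has_vector_derivative[OF bounded_linear_vec_nth that]
    by (simp add: has_real_derivative_iff_has_vector_derivative)
  have df': "(f' has_vector_derivative block2 (step_map (?x t))) (at t within {0..})" if "t \<ge> 0" for t
    unfolding has_vector_derivative_vec_iff
  proof
    fix i
    have "((\<lambda>t. (- damping N i * f t $ i + q t $ i + (u0 $ i - p_e t $ i)) / inertia N i) has_real_derivative
       block2 (step_map (?x t)) $ i) (at t within {0..})"
      by (auto intro!: derivative_eq_intros comp[OF df[OF that]] comp[OF dq[OF that]] comp[OF dpe[OF that]]
          simp: step_map_def diff_divide_distrib)
    then show "((\<lambda>t. f' t $ i) has_vector_derivative block2 (step_map (?x t)) $ i) (at t within {0..})"
      unfolding has_real_derivative_iff_has_vector_derivative
      by (rule has_vector_derivative_transform[rotated 2]) (use that f' in auto)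
  qed
  have dx: "(?x has_vector_derivative A_matrix N *v ?x t) (at t within {0..})" if "t \<ge> 0" for t
    unfolding has_vector_derivative_vec_iff
  proof
    fix j :: "'n + 'n + 'n"
    have "(f has_vector_derivative block1 (step_map (?x t))) (at t within {0..})"
      "(q has_vector_derivative block3 (step_map (?x t))) (at t within {0..})"
      using df[OF that] dq[OF that] by (simp_all add: step_map_def)
    then show "((\<lambda>t. ?x t $ j) has_vector_derivative (A_matrix N *v ?x t) $ j) (at t within {0..})"
      using df'[OF that] unfolding A_matrix_mult has_vector_derivative_vec_iff block1_def block2_def block3_def
      by (cases j rule: sum.exhaust[case_product sum.exhaust]; cases "projr j"; auto)
  qed
  \<comment> \<open>With frequency, internal state and network power all 0 at time 0, the bus
    equation leaves only the step, so the initial acceleration is the jump prescribed by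
    \<open>B\<close>.\<close>
  have "p_e 0 = 0" using has_integral_unique[OF pe[of 0]] by fastforce
  then have x0: "?x 0 = B_matrix N *v u0"
    using f'[of 0] init by (simp add: B_matrix_mult vec3_eq_iff)
  show "state_response (A_matrix N) (B_matrix N) (step_signal u0) ?x"
    unfolding state_response_iff
  proof
    fix t
    show "?x t = (if t < 0 then 0 else matrix_exp (t *\<^sub>R A_matrix N) *v (B_matrix N *v u0))"
      using neg[of t] linear_ode_unique[OF dx, of t] x0 by (cases "t < 0") (simp_all add: vec3_eq_iff)
  qed
  show "t \<ge> 0 \<Longrightarrow> imbalance (?x t) = step_signal u0 t - p_e t"
    using bus by (simp add: imbalance_def vec_eq_iff step_signal_def)
qed

lemma step_response_exists: "\<exists>f f' q p_e. network_step_response N u0 f f' q p_e"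
proof -
  define x where "x t = (if t < 0 then 0 else matrix_exp (t *\<^sub>R A_matrix N) *v (B_matrix N *v u0))" for t
  \<comment> \<open>Defined backwards from the imbalance, so that the bus equation holds by
    construction; the integral equation of the lines then follows from
    \<open>imbalance_step_map\<close>.\<close>
  define p_e where "p_e t = step_signal u0 t - imbalance (x t)" for t
  have x0: "x 0 = B_matrix N *v u0" by (simp add: x_def)
  have neg: "x t = 0" if "t < 0" for t using that by (simp add: x_def)
  have dx: "(x has_vector_derivative step_map (x t)) (at t within {0..})" if "t \<ge> 0" for t
  proof -
    have "(x has_vector_derivative A_matrix N *v (matrix_exp (t *\<^sub>R A_matrix N) *v (B_matrix N *v u0))) (at t within {0..})"
      by (rule has_vector_derivative_transform[rotated 2, OF has_vector_derivative_matrix_exp_mult])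
        (use that in \<open>auto simp: x_def\<close>)
    then show ?thesis using that by (simp add: x_def A_matrix_mult)
  qed
  have dq: "((\<lambda>s. block3 (x s) $ i) has_real_derivative (- droop_coeff i * block1 (x t) $ i - block3 (x t) $ i) / time_const i)
      (at t within {0..})" if "t \<ge> 0" for t i
    using bounded_linear.has_vector_derivative[OF bounded_linear_compose[OF bounded_linear_vec_nth bounded_linear_blocks(3)] dx[OF that], of i]
    by (simp add: has_real_derivative_iff_has_vector_derivative step_map_def)
  have "network_step_response N u0 (\<lambda>t. block1 (x t)) (\<lambda>t. block2 (x t)) (\<lambda>t. block3 (x t)) p_e"
    unfolding network_step_response_def
  proof (intro conjI allI impI ballI)
    fix t :: real assume "t < 0"
    then show "block1 (x t) = 0" "block2 (x t) = 0" "block3 (x t) = 0" "p_e t = 0"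
      by (simp_all add: neg p_e_def step_signal_def imbalance_def block1_def block2_def block3_def vec_eq_iff)
  next
    show "block1 (x 0) = 0" "block3 (x 0) = 0" by (simp_all add: x0 B_matrix_mult)
  next
    fix t :: real assume t: "t \<ge> 0"
    show "((\<lambda>t. block1 (x t)) has_vector_derivative block2 (x t)) (at t within {0..})"
      using bounded_linear.has_vector_derivative[OF bounded_linear_blocks(1) dx[OF t]] by (simp add: step_map_def)
    show "inertia N i * block2 (x t) $ i =
        - damping N i * block1 (x t) $ i + block3 (x t) $ i + (step_signal u0 t - p_e t) $ i" for i
      by (simp add: p_e_def imbalance_def)
    show "\<exists>q'. ((\<lambda>s. block3 (x s) $ i) has_real_derivative q') (at t within {0..}) \<and>
        turb_time N i * q' = - turb_droop N i * block1 (x t) $ i - block3 (x t) $ i" if "i \<in> gens N" for i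
      using dq[OF t, of i] \<tau>_nonzero[of i] that by (intro exI conjI) (auto simp: time_const_def droop_coeff_def)
    show "\<exists>q'. ((\<lambda>s. block3 (x s) $ i) has_real_derivative q') (at t within {0..}) \<and>
        ctrl_time N i * q' = ctrl_gain N i * block1 (x t) $ i - block3 (x t) $ i" if "i \<in> invs N" for i
      using dq[OF t, of i] \<tau>_nonzero[of i] that by (intro exI conjI) (auto simp: time_const_def droop_coeff_def invs_def)
    have "((\<lambda>s. LB_matrix N *v block1 (x s)) has_integral (u0 - imbalance (x t)) - (u0 - imbalance (x 0))) {0..t}"
    proof (rule fundamental_theorem_of_calculus[OF t])
      fix s assume "s \<in> {0..t}"
      then have "((\<lambda>s. u0 - imbalance (x s)) has_vector_derivative LB_matrix N *v block1 (x s)) (at s within {0..})"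
        by (auto intro!: derivative_eq_intros bounded_linear.has_vector_derivative[OF bounded_linear_imbalance dx]
            simp: imbalance_step_map)
      then show "((\<lambda>s. u0 - imbalance (x s)) has_vector_derivative LB_matrix N *v block1 (x s)) (at s within {0..t})"
        by (rule has_vector_derivative_within_subset) auto
    qed
    then show "((\<lambda>s. LB_matrix N *v block1 (x s)) has_integral p_e t) {0..t}"
      using t by (simp add: p_e_def step_signal_def x0 imbalance_B)
  qed
  then show ?thesis by blast
qed

lemma step_response_effort:
  assumes resp: "network_step_response N u0 f f' q p_e"
  defines "u_P \<equiv> \<lambda>t. step_signal u0 t - p_e t"
  shows "(u_P \<longlongrightarrow> Lim at_top u_P) at_top"
    and "\<forall>t\<ge>0. u_P t - Lim at_top u_P = C_matrix N *v stack3 (f t) (f' t) (q t)"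
    and "effort_integrand u_P integrable_on {0..}"
    and "transient_effort u_P = l2_norm_sq (impulse_output (A_matrix N) (B_matrix N) (C_matrix N) u0)"
proof -
  let ?x = "\<lambda>t. stack3 (f t) (f' t) (q t)" and ?y = "impulse_output (A_matrix N) (B_matrix N) (C_matrix N) u0"
  obtain K l where "semistable_system (A_matrix N) (C_matrix N) v w K l"
    using system_semistable by blast
  then interpret semistable_system "A_matrix N" "C_matrix N" v w K l .
  \<comment> \<open>The expected limit. Since the sum of the imbalance is conserved,
    \<open>w \<bullet> x\<close> keeps its initial value, and the part subtracted by
    \<open>C\<close> is this constant.\<close>
  define u where "u = (w \<bullet> (B_matrix N *v u0)) *\<^sub>R equilibrium"
  have x: "?x t = matrix_exp (t *\<^sub>R A_matrix N) *v (B_matrix N *v u0)" if "t \<ge> 0" for t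
    using step_response_state(1)[OF resp] that unfolding state_response_iff by (metis not_less)
  have dev: "u_P t - u = C_matrix N *v ?x t" if "t \<ge> 0" for t
  proof -
    let ?e = "\<lambda>t. matrix_exp (t *\<^sub>R A_matrix N) *v (B_matrix N *v u0)"
    have "trajectory (\<lambda>t. block1 (?e t)) (\<lambda>t. imbalance (?e t)) (\<lambda>t. block3 (?e t))"
      using has_vector_derivative_matrix_exp_mult[of "A_matrix N"] by (intro trajectory_state) (simp add: A_matrix_mult)
    from trajectory_conserved[OF this that] have "w \<bullet> ?x t = w \<bullet> (B_matrix N *v u0)"
      using x[OF that] by (simp add: w_inner)
    then show ?thesis
      using step_response_state(2)[OF resp that] by (simp add: C_matrix_mult u_P_def u_def)
  qed
  have out: "C_matrix N *v ?x t = out (B_matrix N *v u0) t" if "t \<ge> 0" for t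
    using x[OF that] by (simp add: out_def)
  obtain K' where K': "\<And>t. t \<ge> 0 \<Longrightarrow> norm (out (B_matrix N *v u0) t) \<le> K' * exp (- l * t)"
    using out_bound by blast
  have "((\<lambda>t. u_P t - u) \<longlongrightarrow> 0) at_top"
    by (rule exp_decay_tendsto_0[OF rate, where K = K']) (use dev out K' in simp)
  then have lim: "(u_P \<longlongrightarrow> u) at_top" by (simp add: LIM_zero_iff)
  \<comment> \<open>\<open>Lim\<close> is a definite description, meaningful only after convergence
    has been established.\<close>
  then have L: "Lim at_top u_P = u" by (intro tendsto_Lim) auto
  show "(u_P \<longlongrightarrow> Lim at_top u_P) at_top" using lim L by simp
  show "\<forall>t\<ge>0. u_P t - Lim at_top u_P = C_matrix N *v ?x t" using dev L by simp
  have e: "effort_integrand u_P t = (norm (?y t))\<^sup>2" if "t \<in> {0..}" for t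
    using that dev[of t] out[of t] L by (simp add: effort_integrand_def impulse_output_out dot_square_norm)
  show "effort_integrand u_P integrable_on {0..}"
    by (rule integrable_eq[OF impulse_output_energy(1)]) (simp add: e)
  show "transient_effort u_P = l2_norm_sq ?y"
    unfolding transient_effort_def l2_norm_sq_def by (rule integral_cong) (rule e)
qed

end

theorem theorem1:
  fixes N :: "('n::finite) network" and \<Delta>P :: real
  defines "A \<equiv> A_matrix N" and "B \<equiv> B_matrix N" and "C \<equiv> C_matrix N"
    and "X \<equiv> observability_gramian (A_matrix N) (C_matrix N)"
  assumes "transmission_network N" and "bus_parameters N" and "frequency_shaping N"
    and "\<Delta>P \<ge> 0"
  shows
    \<comment> \<open>the system with matrices \<open>A, B, C\<close> maps the derivative of the step disturbance to the deviation
       of the net power imbalance from its steady state\<close>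
    "(\<forall>u0 :: real^'n. \<bar>\<Sum>i\<in>UNIV. u0 $ i\<bar> = \<Delta>P \<longrightarrow>
        (\<exists>\<omega> \<omega>' q p_e. network_step_response N u0 \<omega> \<omega>' q p_e) \<and>
        (\<forall>\<omega> \<omega>' q p_e. network_step_response N u0 \<omega> \<omega>' q p_e \<longrightarrow>
          (let u_P = (\<lambda>t. step_signal u0 t - p_e t);
               x = (\<lambda>t. stack3 (\<omega> t) (\<omega>' t) (q t))
           in (u_P \<longlongrightarrow> Lim at_top u_P) at_top \<and>
              state_response A B (step_signal u0) x \<and>
              (\<forall>t\<ge>0. u_P t - Lim at_top u_P = C *v x t) \<and>
              effort_integrand u_P integrable_on {0..} \<and>
              transient_effort u_P = l2_norm_sq (impulse_output A B C u0))))
     \<comment> \<open>well-posedness, and the estimate of the transient control effort\<close>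
     \<and> (\<forall>u :: real^'n. \<exists>!x. state_response A B (step_signal u) x)
     \<and> (\<forall>u :: real^'n. (\<lambda>t. (norm (impulse_output A B C u t))\<^sup>2) integrable_on {0..})
     \<and> effort_estimate N \<Delta>P = \<Delta>P\<^sup>2 / real CARD('n) * h2_norm_sq A B C
     \<and> \<Delta>P\<^sup>2 / real CARD('n) * h2_norm_sq A B C =
         \<Delta>P\<^sup>2 / real CARD('n) * trace (transpose B ** X ** B)
     \<comment> \<open>the observability Gramian and its characterization\<close>
     \<and> gramian_integrand A C integrable_on {0..}
     \<and> (\<forall>Y. transpose A ** Y + Y ** A = - (transpose C ** C) \<and> Y *v v_vector N = 0 \<longleftrightarrow> Y = X)"
proof -
  interpret shaped_network N by unfold_locales fact+
  obtain K l where "semistable_system (A_matrix N) (C_matrix N) v w K l"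
    using system_semistable by blast
  then interpret semistable_system A C v w K l unfolding A_def C_def .
  have X: "X = observability_gramian A C" by (simp add: A_def C_def X_def)
  have effort: "effort_estimate N \<Delta>P = \<Delta>P\<^sup>2 / real CARD('n) * h2_norm_sq A B C"
    unfolding effort_estimate_def h2_norm_sq_def A_def[symmetric] B_def[symmetric] C_def[symmetric] l2_norm_sq_scaleR
    by (simp flip: sum_distrib_left)
  have lyap: "transpose A ** Y + Y ** A = - (transpose C ** C) \<and> Y *v v_vector N = 0 \<longleftrightarrow> Y = X" for Y
    unfolding X v_vector_eq using gramian_lyapunov gramian_v lyapunov_unique by blast
  have unique: "\<exists>!x. state_response A B (step_signal u) x" for u :: "real^'n"
    unfolding state_response_iff by simp
  have energy: "\<Delta>P\<^sup>2 / real CARD('n) * h2_norm_sq A B C = \<Delta>P\<^sup>2 / real CARD('n) * trace (transpose B ** X ** B)"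
    by (simp only: X h2_norm_sq_eq_trace)
  show ?thesis
    unfolding Let_def
    using step_response_exists step_response_effort step_response_state(1) effort lyap unique
      impulse_output_energy(1) energy gramian_integrand_integrable
    by (intro conjI allI impI) (simp_all only: A_def B_def C_def X)
qed

end
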